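(* Let $X$ be a compact manifold, let $(g_t,J_t)_t$ be a smooth path of Kähler structures on $X$ such that, for all $t$, $\dot J_t=(\dot J_t)^T_{g_t}$ and $\dot g_t\in\mathbb F_{g_t}$. Let $\Omega>0$ be a smooth volume form on $X$ and $f_t:=\log\frac{dV_{g_t}}{\Omega}$. Put $\dot g_t^{*}:=g_t^{-1}\dot g_t$, $\dot g_t^{1,0}:=(\dot g_t^{*})^{1,0}_{J_t}$, $\dot g_t^{0,1}:=(\dot g_t^{*})^{0,1}_{J_t}$. Then the following first variation identity holds for the $J_t$-anti-linear part of the endomorphism $\nabla^2_{g_t}f_t$: \begin{align*} 2\,\frac{d}{dt}\Big(\bar\partial_{T_{X,J_t}}\nabla_{g_t}f_t\Big) ={}&-2\,\bar\partial_{T_{X,J_t}}\bar\partial^{*_{g_t}}_{T_{X,J_t}}\dot g_t^{0,1}-\nabla_{g_t}f_t\,\neg\,\nabla_{g_t}\dot g_t^{0,1}\\ &-\dot g_t^{0,1}\,\partial^{g_t}_{T_{X,J_t}}\nabla_{g_t}f_t-\partial^{g_t}_{T_{X,J_t}}\nabla_{g_t}f_t\;\dot g_t^{0,1}\\ &+\big[\bar\partial_{T_{X,J_t}}\nabla_{g_t}f_t,\dot g_t^{0,1}\big]-2\,\dot g_t^{1,0}\,\bar\partial_{T_{X,J_t}}\nabla_{g_t}f_t . \end{align*}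
   Context: A Kähler structure on $X$ is a pair $(J,g)$ with $J$ a smooth almost complex structure, $g$ a smooth Riemannian metric, $g(J\cdot,J\cdot)=g$ and $\nabla_gJ=0$, where $\nabla_g$ is the Levi-Civita connection. A dot denotes $d/dt$. $A^T_g$ is the $g$-transpose of an endomorphism $A$ of $T_X$; $[S,T]=ST-TS$; juxtaposition is composition. $v^*_g=g^{-1}v$ is the endomorphism with $g(v_g^*\xi,\eta)=v(\xi,\eta)$. For an endomorphism $S$ of $T_X$: $S^{1,0}_J=\frac12(S-JSJ)$, $S^{0,1}_J=\frac12(S+JSJ)$. $\nabla_gf$ is the gradient, $\nabla_g^2f=\nabla_g\nabla_gf$ the Hessian endomorphism, and $\xi\neg\nabla_gS=\nabla_{g,\xi}S$. $\mathbb F_g:=\{v\in C^\infty(X,S^2_{\mathbb R}T_X^* )\;:\;\nabla_{T_X,g}v_g^*=0\}$, where $\nabla_{T_X,g}$ is the covariant exterior derivative (for the Levi-Civita connection) on $T_X$-valued forms and $v_g^*$ is viewed as a $T_X$-valued $1$-form; i.e. $(\nabla_{g,\xi}v^*_g)\eta=(\nabla_{g,\eta}v_g^* )\xi$. Complex operators: on vector fields, $2\,\partial^g_{T_{X,J}}\xi=\nabla_g\xi-J\nabla_g\xi J$ and $2\,\bar\partial_{T_{X,J}}\xi=\nabla_g\xi+J\nabla_g\xi J$. $\bar\partial^{*_g}_{T_{X,J}}$ is the formal adjoint of $\bar\partial_{T_{X,J}}$; on a $T_X$-valued $1$-form (endomorphism) $S$ it is $\bar\partial^{*_g}_{T_{X,J}}S=-\operatorname{Tr}_g\nabla^{1,0}_{g,J}S=-\sum_k\nabla^{1,0}_{g,J}S(e_k,e_k)$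 for a $g$-orthonormal basis $(e_k)$, where $2\nabla^{1,0}_{g,J}S(\xi,\eta)=(\nabla_{g,\xi}S)\eta-J(\nabla_{g,J\xi}S)\eta$. *)

theory Defs
  imports "HOL-Analysis.Analysis"
begin

section \<open>Smooth maps\<close>

text \<open>Meant for open \<open>S\<close>: all iterated directional derivatives up to order \<open>k\<close> exist and are
  continuous on \<open>S\<close>.\<close>

fun Ck_on :: "nat \<Rightarrow> 'a set \<Rightarrow> ('a::real_normed_vector \<Rightarrow> 'b::real_normed_vector) \<Rightarrow> bool" where
  "Ck_on 0 S f \<longleftrightarrow> continuous_on S f"
| "Ck_on (Suc k) S f \<longleftrightarrow> (\<forall>x\<in>S. f differentiable (at x)) \<and>
     (\<forall>v. Ck_on k S (\<lambda>x. frechet_derivative f (at x) v))"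

definition smooth_on :: "'a set \<Rightarrow> ('a::real_normed_vector \<Rightarrow> 'b::real_normed_vector) \<Rightarrow> bool" where
  "smooth_on S f \<longleftrightarrow> (\<forall>k. Ck_on k S f)"

section \<open>Smooth manifolds\<close>

text \<open>A chart \<open>(U, \<phi>)\<close>; only the values of \<open>\<phi>\<close> on \<open>U\<close> matter.\<close>

type_synonym ('m, 'n) chart = "'m set \<times> ('m \<Rightarrow> real^'n)"

definition chart_img :: "('m, 'n) chart \<Rightarrow> (real^'n) set" where
  "chart_img c = snd c ` fst c"

definition chart_inv :: "('m, 'n) chart \<Rightarrow> real^'n \<Rightarrow> 'm" where
  "chart_inv c = inv_into (fst c) (snd c)"

definition overlap :: "('m, 'n) chart \<Rightarrow> ('m, 'n) chart \<Rightarrow> (real^'n) set" where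
  "overlap c c' = snd c ` (fst c \<inter> fst c')"

definition transition :: "('m, 'n) chart \<Rightarrow> ('m, 'n) chart \<Rightarrow> real^'n \<Rightarrow> real^'n" where
  "transition c c' = snd c' \<circ> chart_inv c"

definition jacobian :: "('m, 'n::finite) chart \<Rightarrow> ('m, 'n) chart \<Rightarrow> real^'n \<Rightarrow> real^'n^'n" where
  "jacobian c c' y = matrix (frechet_derivative (transition c c') (at y))"

definition smooth_atlas ::
  "'m::topological_space set \<Rightarrow> ('m, 'n::finite) chart set \<Rightarrow> bool" where
  "smooth_atlas X A \<longleftrightarrow>
     (\<Union>c\<in>A. fst c) = X \<and>
     (\<forall>c\<in>A. openin (top_of_set X) (fst c) \<and> open (chart_img c) \<and>
            homeomorphism (fst c) (chart_img c) (snd c) (chart_inv c)) \<and>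
     (\<forall>c\<in>A. \<forall>c'\<in>A. smooth_on (overlap c c') (transition c c'))"

text \<open>The Hausdorff axiom comes from the class \<open>t2_space\<close>; second countability follows from
  compactness.\<close>

definition compact_manifold ::
  "'m::t2_space set \<Rightarrow> ('m, 'n::finite) chart set \<Rightarrow> bool" where
  "compact_manifold X A \<longleftrightarrow> compact X \<and> smooth_atlas X A"

section \<open>Tensor fields\<close>

text \<open>A tensor field on a manifold is given classically, by its components in each chart of the
  atlas, as functions of the coordinates, subject to the transformation law on overlaps. The
  component matrix of a bilinear form \<open>v\<close> is \<open>v $ i $ j = v(\<partial>\<^sub>i, \<partial>\<^sub>j)\<close>, that of an endomorphism \<open>S\<close>
  is the matrix acting on column vectors, \<open>S \<partial>\<^sub>j = (\<Sum>k. S $ k $ j \<cdot> \<partial>\<^sub>k)\<close>, and a form \<open>\<omega>\<close> of top degree is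
  represented by \<open>\<omega>(\<partial>\<^sub>1, \<dots>, \<partial>\<^sub>n)\<close>.\<close>

type_synonym ('m, 'n, 'b) field = "('m, 'n) chart \<Rightarrow> real^'n \<Rightarrow> 'b"

definition smooth_field ::
  "('m, 'n::finite) chart set \<Rightarrow> ('m, 'n, 'b::real_normed_vector) field \<Rightarrow> bool" where
  "smooth_field A S \<longleftrightarrow> (\<forall>c\<in>A. smooth_on (chart_img c) (S c))"

definition bilinear_field ::
  "('m, 'n::finite) chart set \<Rightarrow> ('m, 'n, real^'n^'n) field \<Rightarrow> bool" where
  "bilinear_field A v \<longleftrightarrow> (\<forall>c\<in>A. \<forall>c'\<in>A. \<forall>y\<in>overlap c c'.
     v c y = transpose (jacobian c c' y) ** v c' (transition c c' y) ** jacobian c c' y)"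

definition endo_field ::
  "('m, 'n::finite) chart set \<Rightarrow> ('m, 'n, real^'n^'n) field \<Rightarrow> bool" where
  "endo_field A S \<longleftrightarrow> (\<forall>c\<in>A. \<forall>c'\<in>A. \<forall>y\<in>overlap c c'.
     S c' (transition c c' y) ** jacobian c c' y = jacobian c c' y ** S c y)"

definition top_form_field ::
  "('m, 'n::finite) chart set \<Rightarrow> ('m, 'n, real) field \<Rightarrow> bool" where
  "top_form_field A \<omega> \<longleftrightarrow> (\<forall>c\<in>A. \<forall>c'\<in>A. \<forall>y\<in>overlap c c'.
     \<omega> c y = det (jacobian c c' y) * \<omega> c' (transition c c' y))"

section \<open>Linear algebra on a tangent space\<close>

definition sharp :: "real^'n::finite^'n \<Rightarrow> real^'n^'n \<Rightarrow> real^'n^'n" where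
  "sharp G V = matrix_inv G ** V"

definition gtranspose :: "real^'n::finite^'n \<Rightarrow> real^'n^'n \<Rightarrow> real^'n^'n" where
  "gtranspose G S = matrix_inv G ** transpose S ** G"

definition metric_trace ::
  "real^'n::finite^'n \<Rightarrow> (real^'n \<Rightarrow> real^'n \<Rightarrow> 'b::real_vector) \<Rightarrow> 'b" where
  "metric_trace G B = (\<Sum>i\<in>UNIV. \<Sum>j\<in>UNIV. (matrix_inv G $ i $ j) *\<^sub>R B (axis i 1) (axis j 1))"

definition part10 :: "real^'n::finite^'n \<Rightarrow> real^'n^'n \<Rightarrow> real^'n^'n" where
  "part10 J S = (1/2) *\<^sub>R (S - J ** S ** J)"

definition part01 :: "real^'n::finite^'n \<Rightarrow> real^'n^'n \<Rightarrow> real^'n^'n" where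
  "part01 J S = (1/2) *\<^sub>R (S + J ** S ** J)"

definition commutator :: "real^'n::finite^'n \<Rightarrow> real^'n^'n \<Rightarrow> real^'n^'n" where
  "commutator S T = S ** T - T ** S"

definition inner_product_matrix :: "real^'n::finite^'n \<Rightarrow> bool" where
  "inner_product_matrix G \<longleftrightarrow> transpose G = G \<and> (\<forall>u. u \<noteq> 0 \<longrightarrow> u \<bullet> (G *v u) > 0)"

section \<open>Riemannian calculus in a chart\<close>

text \<open>In this section \<open>g\<close>, \<open>\<xi>\<close>, \<open>S\<close>, \<open>f\<close> are the components of a metric, a vector field, an
  endomorphism field and a function in one fixed chart.\<close>

definition pderiv_at :: "(real^'n::finite \<Rightarrow> 'b::real_normed_vector) \<Rightarrow> real^'n \<Rightarrow> 'n \<Rightarrow> 'b" where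
  "pderiv_at f y i = frechet_derivative f (at y) (axis i 1)"

text \<open>The Levi-Civita connection: \<open>christoffel g y i j k\<close> is \<open>\<Gamma>\<^sup>k\<^sub>i\<^sub>j\<close>, i.e.
  \<open>\<nabla>\<^sub>\<partial>\<^sub>i \<partial>\<^sub>j = (\<Sum>k. \<Gamma>\<^sup>k\<^sub>i\<^sub>j \<cdot> \<partial>\<^sub>k)\<close>.\<close>

definition christoffel ::
  "(real^'n::finite \<Rightarrow> real^'n^'n) \<Rightarrow> real^'n \<Rightarrow> 'n \<Rightarrow> 'n \<Rightarrow> 'n \<Rightarrow> real" where
  "christoffel g y i j k = (1/2) * (\<Sum>l\<in>UNIV. matrix_inv (g y) $ k $ l *
     (pderiv_at g y i $ j $ l + pderiv_at g y j $ i $ l - pderiv_at g y l $ i $ j))"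

definition connection_matrix ::
  "(real^'n::finite \<Rightarrow> real^'n^'n) \<Rightarrow> real^'n \<Rightarrow> real^'n \<Rightarrow> real^'n^'n" where
  "connection_matrix g y v = (\<chi> k j. \<Sum>i\<in>UNIV. v $ i * christoffel g y i j k)"

text \<open>\<open>nabla_vec g \<xi> y\<close> is the endomorphism \<open>v \<mapsto> \<nabla>\<^sub>v \<xi>\<close> at \<open>y\<close>, and \<open>nabla_endo g S y v\<close> is
  \<open>\<nabla>\<^sub>v S\<close> at \<open>y\<close>.\<close>

definition nabla_vec ::
  "(real^'n::finite \<Rightarrow> real^'n^'n) \<Rightarrow> (real^'n \<Rightarrow> real^'n) \<Rightarrow> real^'n \<Rightarrow> real^'n^'n" where
  "nabla_vec g \<xi> y =
     matrix (\<lambda>v. frechet_derivative \<xi> (at y) v + connection_matrix g y v *v \<xi> y)"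

definition nabla_endo ::
  "(real^'n::finite \<Rightarrow> real^'n^'n) \<Rightarrow> (real^'n \<Rightarrow> real^'n^'n) \<Rightarrow> real^'n \<Rightarrow> real^'n \<Rightarrow> real^'n^'n" where
  "nabla_endo g S y v =
     frechet_derivative S (at y) v + commutator (connection_matrix g y v) (S y)"

definition grad :: "(real^'n::finite \<Rightarrow> real^'n^'n) \<Rightarrow> (real^'n \<Rightarrow> real) \<Rightarrow> real^'n \<Rightarrow> real^'n" where
  "grad g f y = matrix_inv (g y) *v (\<chi> i. pderiv_at f y i)"

section \<open>Complex operators in a chart\<close>

definition del_vec ::
  "(real^'n::finite \<Rightarrow> real^'n^'n) \<Rightarrow> (real^'n \<Rightarrow> real^'n^'n) \<Rightarrow> (real^'n \<Rightarrow> real^'n) \<Rightarrow>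
   real^'n \<Rightarrow> real^'n^'n" where
  "del_vec g J \<xi> y = (1/2) *\<^sub>R (nabla_vec g \<xi> y - J y ** nabla_vec g \<xi> y ** J y)"

definition delbar_vec ::
  "(real^'n::finite \<Rightarrow> real^'n^'n) \<Rightarrow> (real^'n \<Rightarrow> real^'n^'n) \<Rightarrow> (real^'n \<Rightarrow> real^'n) \<Rightarrow>
   real^'n \<Rightarrow> real^'n^'n" where
  "delbar_vec g J \<xi> y = (1/2) *\<^sub>R (nabla_vec g \<xi> y + J y ** nabla_vec g \<xi> y ** J y)"

definition nabla10_endo ::
  "(real^'n::finite \<Rightarrow> real^'n^'n) \<Rightarrow> (real^'n \<Rightarrow> real^'n^'n) \<Rightarrow> (real^'n \<Rightarrow> real^'n^'n) \<Rightarrow>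
   real^'n \<Rightarrow> real^'n \<Rightarrow> real^'n \<Rightarrow> real^'n" where
  "nabla10_endo g J S y u v =
     (1/2) *\<^sub>R (nabla_endo g S y u *v v - J y *v (nabla_endo g S y (J y *v u) *v v))"

definition delbar_star ::
  "(real^'n::finite \<Rightarrow> real^'n^'n) \<Rightarrow> (real^'n \<Rightarrow> real^'n^'n) \<Rightarrow> (real^'n \<Rightarrow> real^'n^'n) \<Rightarrow>
   real^'n \<Rightarrow> real^'n" where
  "delbar_star g J S y = - metric_trace (g y) (nabla10_endo g J S y)"

section \<open>Structures on the manifold\<close>

definition riemannian_metric ::
  "('m, 'n::finite) chart set \<Rightarrow> ('m, 'n, real^'n^'n) field \<Rightarrow> bool" where
  "riemannian_metric A g \<longleftrightarrow> smooth_field A g \<and> bilinear_field A g \<and>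
     (\<forall>c\<in>A. \<forall>y\<in>chart_img c. inner_product_matrix (g c y))"

definition almost_complex ::
  "('m, 'n::finite) chart set \<Rightarrow> ('m, 'n, real^'n^'n) field \<Rightarrow> bool" where
  "almost_complex A J \<longleftrightarrow> smooth_field A J \<and> endo_field A J \<and>
     (\<forall>c\<in>A. \<forall>y\<in>chart_img c. J c y ** J c y = - mat 1)"

definition kaehler_structure ::
  "('m, 'n::finite) chart set \<Rightarrow> ('m, 'n, real^'n^'n) field \<Rightarrow> ('m, 'n, real^'n^'n) field \<Rightarrow> bool" where
  "kaehler_structure A J g \<longleftrightarrow> almost_complex A J \<and> riemannian_metric A g \<and>
     (\<forall>c\<in>A. \<forall>y\<in>chart_img c. transpose (J c y) ** g c y ** J c y = g c y) \<and>
     (\<forall>c\<in>A. \<forall>y\<in>chart_img c. \<forall>v. nabla_endo (g c) (J c) y v = 0)"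

definition smooth_path ::
  "('m, 'n::finite) chart set \<Rightarrow> real set \<Rightarrow> (real \<Rightarrow> ('m, 'n, 'b::real_normed_vector) field) \<Rightarrow> bool" where
  "smooth_path A T S \<longleftrightarrow> (\<forall>c\<in>A. smooth_on (T \<times> chart_img c) (\<lambda>(t, y). S t c y))"

definition smooth_kaehler_path ::
  "('m, 'n::finite) chart set \<Rightarrow> real set \<Rightarrow>
   (real \<Rightarrow> ('m, 'n, real^'n^'n) field) \<Rightarrow> (real \<Rightarrow> ('m, 'n, real^'n^'n) field) \<Rightarrow> bool" where
  "smooth_kaehler_path A T J g \<longleftrightarrow> smooth_path A T J \<and> smooth_path A T g \<and>
     (\<forall>t\<in>T. kaehler_structure A (J t) (g t))"

definition time_deriv ::
  "(real \<Rightarrow> ('m, 'n, 'b::real_normed_vector) field) \<Rightarrow> real \<Rightarrow> ('m, 'n, 'b) field" where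
  "time_deriv S t c y = vector_derivative (\<lambda>s. S s c y) (at t)"

definition F_space ::
  "('m, 'n::finite) chart set \<Rightarrow> ('m, 'n, real^'n^'n) field \<Rightarrow> ('m, 'n, real^'n^'n) field set" where
  "F_space A g = {v. smooth_field A v \<and> bilinear_field A v \<and>
     (\<forall>c\<in>A. \<forall>y\<in>chart_img c. transpose (v c y) = v c y) \<and>
     (\<forall>c\<in>A. \<forall>y\<in>chart_img c. \<forall>\<xi> \<eta>.
        nabla_endo (g c) (\<lambda>z. sharp (g c z) (v c z)) y \<xi> *v \<eta> =
        nabla_endo (g c) (\<lambda>z. sharp (g c z) (v c z)) y \<eta> *v \<xi>)}"

text \<open>A volume form is a nowhere vanishing form of top degree \<open>\<Omega>\<close>, and \<open>\<Omega> > 0\<close> means that the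
  manifold is oriented by it. \<open>riemannian_volume \<Omega> g\<close> is the Riemannian volume form of \<open>g\<close> for
  this orientation. The function \<open>log (dV\<^sub>g / \<Omega>)\<close> is the same for every orientation with
  respect to which \<open>\<Omega>\<close> and \<open>dV\<^sub>g\<close> are both positive.\<close>

definition volume_form ::
  "('m, 'n::finite) chart set \<Rightarrow> ('m, 'n, real) field \<Rightarrow> bool" where
  "volume_form A \<Omega> \<longleftrightarrow> smooth_field A \<Omega> \<and> top_form_field A \<Omega> \<and>
     (\<forall>c\<in>A. \<forall>y\<in>chart_img c. \<Omega> c y \<noteq> 0)"

definition riemannian_volume ::
  "('m, 'n::finite, real) field \<Rightarrow> ('m, 'n, real^'n^'n) field \<Rightarrow> ('m, 'n, real) field" where
  "riemannian_volume \<Omega> g c y = sgn (\<Omega> c y) * sqrt (det (g c y))"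

definition log_volume_ratio ::
  "('m, 'n::finite, real) field \<Rightarrow> ('m, 'n, real^'n^'n) field \<Rightarrow> ('m, 'n, real) field" where
  "log_volume_ratio \<Omega> g c y = ln (riemannian_volume \<Omega> g c y / \<Omega> c y)"

section \<open>Consistency checks\<close>

lemma inner_product_matrix_inverse:
  fixes G :: "real^'n::finite^'n"
  assumes "inner_product_matrix G"
  shows "G ** matrix_inv G = mat 1" "matrix_inv G ** G = mat 1"
proof -
  have "\<forall>x. G *v x = 0 \<longrightarrow> x = 0"
    using assms unfolding inner_product_matrix_def by (metis inner_zero_right less_irrefl)
  then obtain B where "B ** G = mat 1"
    using matrix_left_invertible_ker by blast
  then have "\<exists>B. G ** B = mat 1 \<and> B ** G = mat 1"
    using matrix_left_right_inverse by blast
  then have "G ** matrix_inv G = mat 1 \<and> matrix_inv G ** G = mat 1"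
    unfolding matrix_inv_def by (rule someI_ex)
  then show "G ** matrix_inv G = mat 1" "matrix_inv G ** G = mat 1" by auto
qed

lemma inner_matrix_transpose:
  fixes M :: "real^'n::finite^'n"
  shows "x \<bullet> (M *v y) = (transpose M *v x) \<bullet> y"
  by (simp add: dot_lmul_matrix)

lemma sharp_eq:
  assumes G: "inner_product_matrix G" and V: "transpose V = V"
  shows "(sharp G V *v \<xi>) \<bullet> (G *v \<eta>) = \<xi> \<bullet> (V *v \<eta>)"
proof -
  have "(sharp G V *v \<xi>) \<bullet> (G *v \<eta>) = (G *v (sharp G V *v \<xi>)) \<bullet> \<eta>"
    using G by (metis inner_matrix_transpose inner_product_matrix_def)
  also have "\<dots> = (V *v \<xi>) \<bullet> \<eta>"
    using G by (simp add: sharp_def matrix_vector_mul_assoc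
        matrix_mul_assoc inner_product_matrix_inverse matrix_mul_lid)
  also have "\<dots> = \<xi> \<bullet> (V *v \<eta>)"
    using V by (metis inner_matrix_transpose)
  finally show ?thesis .
qed

lemma gtranspose_eq:
  assumes "inner_product_matrix G"
  shows "(S *v \<xi>) \<bullet> (G *v \<eta>) = \<xi> \<bullet> (G *v (gtranspose G S *v \<eta>))"
proof -
  have "\<xi> \<bullet> (G *v (gtranspose G S *v \<eta>)) = \<xi> \<bullet> (transpose S *v (G *v \<eta>))"
    using assms by (simp add: gtranspose_def matrix_vector_mul_assoc matrix_mul_assoc
        inner_product_matrix_inverse matrix_mul_lid)
  then show ?thesis
    by (metis inner_matrix_transpose transpose_transpose)
qed

text \<open>The metric trace is the sum over any orthonormal basis.\<close>

lemma metric_trace_orthonormal: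
  fixes G :: "real^'n::finite^'n" and B :: "real^'n \<Rightarrow> real^'n \<Rightarrow> 'b::real_vector"
    and e :: "'n \<Rightarrow> real^'n"
  assumes B: "\<And>v. linear (\<lambda>u. B u v)" "\<And>u. linear (B u)"
    and e: "\<And>k l. e k \<bullet> (G *v e l) = (if k = l then 1 else 0)"
    and G: "inner_product_matrix G"
  shows "metric_trace G B = (\<Sum>k\<in>UNIV. B (e k) (e k))"
proof -
  define E :: "real^'n^'n" where "E = (\<chi> i k. e k $ i)"
  have col: "E *v axis k 1 = e k" for k
    by (simp add: E_def vec_eq_iff matrix_vector_mul_component inner_axis)
  have "transpose E ** G ** E = mat 1"
  proof -
    have "(transpose E ** G ** E) $ k $ l = e k \<bullet> (G *v e l)" for k l
    proof -
      have "(transpose E ** G ** E) $ k $ l = axis k 1 \<bullet> ((transpose E ** G ** E) *v axis l 1)"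
        by (simp add: inner_axis' matrix_vector_mul_component inner_axis)
      also have "\<dots> = axis k 1 \<bullet> (transpose E *v (G *v e l))"
        by (simp add: matrix_vector_mul_assoc[symmetric] col)
      also have "\<dots> = e k \<bullet> (G *v e l)"
        by (metis col inner_matrix_transpose transpose_transpose)
      finally show ?thesis .
    qed
    then show ?thesis by (simp add: e vec_eq_iff mat_def)
  qed
  then have "E ** (transpose E ** G) = mat 1"
    using matrix_left_right_inverse by blast
  then have "E ** transpose E ** G ** matrix_inv G = matrix_inv G"
    by (simp add: matrix_mul_assoc matrix_mul_lid)
  then have "E ** transpose E ** (G ** matrix_inv G) = matrix_inv G"
    by (simp add: matrix_mul_assoc)
  then have inv: "matrix_inv G = E ** transpose E"
    using G by (simp add: inner_product_matrix_inverse matrix_mul_rid)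
  have ent: "matrix_inv G $ i $ j = (\<Sum>k\<in>UNIV. e k $ i * e k $ j)" for i j
    unfolding inv by (simp add: matrix_matrix_mult_def transpose_def E_def)
  have exp: "e k = (\<Sum>i\<in>UNIV. (e k $ i) *\<^sub>R axis i 1)" for k
    using basis_expansion[of "e k"] by (simp add: scalar_mult_eq_scaleR)
  have "B (e k) (e k) =
      (\<Sum>i\<in>UNIV. \<Sum>j\<in>UNIV. (e k $ i * e k $ j) *\<^sub>R B (axis i 1) (axis j 1))" for k
  proof -
    have "B (e k) (e k) = B (\<Sum>i\<in>UNIV. (e k $ i) *\<^sub>R axis i 1) (e k)"
      using exp[of k] by simp
    also have "\<dots> = (\<Sum>i\<in>UNIV. (e k $ i) *\<^sub>R B (axis i 1) (e k))"
      using B(1) by (simp add: linear_sum[OF B(1)] linear_scale[OF B(1)])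
    also have "\<dots> = (\<Sum>i\<in>UNIV. (e k $ i) *\<^sub>R B (axis i 1) (\<Sum>j\<in>UNIV. (e k $ j) *\<^sub>R axis j 1))"
      using exp[of k] by simp
    also have "\<dots> = (\<Sum>i\<in>UNIV. \<Sum>j\<in>UNIV. (e k $ i * e k $ j) *\<^sub>R B (axis i 1) (axis j 1))"
      by (simp add: linear_sum[OF B(2)] linear_scale[OF B(2)] scaleR_sum_right)
    finally show ?thesis .
  qed
  then have "(\<Sum>k\<in>UNIV. B (e k) (e k)) =
      (\<Sum>k\<in>UNIV. \<Sum>i\<in>UNIV. \<Sum>j\<in>UNIV. (e k $ i * e k $ j) *\<^sub>R B (axis i 1) (axis j 1))"
    by simp
  also have "\<dots> = (\<Sum>i\<in>UNIV. \<Sum>k\<in>UNIV. \<Sum>j\<in>UNIV. (e k $ i * e k $ j) *\<^sub>R B (axis i 1) (axis j 1))"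
    by (rule sum.swap)
  also have "\<dots> = (\<Sum>i\<in>UNIV. \<Sum>j\<in>UNIV. \<Sum>k\<in>UNIV. (e k $ i * e k $ j) *\<^sub>R B (axis i 1) (axis j 1))"
    by (intro sum.cong refl sum.swap)
  also have "\<dots> = metric_trace G B"
    by (simp add: metric_trace_def ent scaleR_sum_left)
  finally show ?thesis by simp
qed

text \<open>The connection is torsion-free and compatible with the metric, and it is the only such one.\<close>

lemma pderiv_symmetric:
  fixes g :: "real^'n::finite \<Rightarrow> real^'n^'n"
  assumes "open V" "y \<in> V" "\<And>z. z \<in> V \<Longrightarrow> transpose (g z) = g z" "g differentiable (at y)"
  shows "pderiv_at g y i $ j $ k = pderiv_at g y i $ k $ j"
proof -
  have tr: "bounded_linear (transpose :: real^'n^'n \<Rightarrow> real^'n^'n)"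
    unfolding linear_conv_bounded_linear[symmetric]
    by (rule linearI) (simp_all add: transpose_def vec_eq_iff)
  have d: "(g has_derivative frechet_derivative g (at y)) (at y)"
    using assms(4) frechet_derivative_works by blast
  have "((\<lambda>z. transpose (g z)) has_derivative (\<lambda>v. transpose (frechet_derivative g (at y) v))) (at y)"
    using bounded_linear.has_derivative[OF tr d] .
  then have "(g has_derivative (\<lambda>v. transpose (frechet_derivative g (at y) v))) (at y)"
    by (rule has_derivative_transform_within_open[OF _ assms(1,2)]) (use assms(3) in auto)
  then have "frechet_derivative g (at y) = (\<lambda>v. transpose (frechet_derivative g (at y) v))"
    using d has_derivative_unique by blast
  then have "frechet_derivative g (at y) (axis i 1) = transpose (frechet_derivative g (at y) (axis i 1))"
    by meson
  then show ?thesis unfolding pderiv_at_def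
    by (metis (no_types, lifting) transpose_def vec_lambda_beta)
qed

lemma christoffel_lower:
  assumes "inner_product_matrix (g y)"
  shows "(\<Sum>k\<in>UNIV. g y $ m $ k * christoffel g y i j k) =
     (1/2) * (pderiv_at g y i $ j $ m + pderiv_at g y j $ i $ m - pderiv_at g y m $ i $ j)"
proof -
  define w where "w = (\<chi> l. pderiv_at g y i $ j $ l + pderiv_at g y j $ i $ l - pderiv_at g y l $ i $ j)"
  have c: "christoffel g y i j k = (1/2) * (matrix_inv (g y) *v w) $ k" for k
    by (simp add: christoffel_def w_def matrix_vector_mult_def)
  have "(\<Sum>k\<in>UNIV. g y $ m $ k * christoffel g y i j k) = (1/2) * (g y *v (matrix_inv (g y) *v w)) $ m"
    by (simp only: c) (simp add: matrix_vector_mult_def[of "g y"] sum_distrib_left mult_ac sum_divide_distrib)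
  also have "\<dots> = (1/2) * w $ m"
    using assms by (simp add: matrix_vector_mul_assoc inner_product_matrix_inverse)
  finally show ?thesis by (simp add: w_def)
qed

lemma levi_civita:
  assumes "open V" "y \<in> V" "\<And>z. z \<in> V \<Longrightarrow> inner_product_matrix (g z)" "g differentiable (at y)"
  shows "christoffel g y i j k = christoffel g y j i k"
    and "pderiv_at g y i $ j $ m =
      (\<Sum>k\<in>UNIV. g y $ m $ k * christoffel g y i j k) + (\<Sum>k\<in>UNIV. g y $ j $ k * christoffel g y i m k)"
proof -
  have s: "pderiv_at g y i $ j $ k = pderiv_at g y i $ k $ j" for i j k
    by (rule pderiv_symmetric[OF assms(1,2) _ assms(4)])
       (use assms(3) in \<open>auto simp: inner_product_matrix_def\<close>)
  show "christoffel g y i j k = christoffel g y j i k"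
    unfolding christoffel_def by (simp add: s[of _ i j] add_ac)
  show "pderiv_at g y i $ j $ m =
      (\<Sum>k\<in>UNIV. g y $ m $ k * christoffel g y i j k) + (\<Sum>k\<in>UNIV. g y $ j $ k * christoffel g y i m k)"
    unfolding christoffel_lower[where g = g and y = y, OF assms(3)[OF assms(2)]]
    by (simp add: s[of _ m j] s[of _ i j] s[of _ i m] field_simps)
qed

lemma levi_civita_unique:
  fixes \<Gamma> :: "'n::finite \<Rightarrow> 'n \<Rightarrow> 'n \<Rightarrow> real"
  assumes G: "inner_product_matrix (g y)"
    and sym: "\<And>i j k. \<Gamma> i j k = \<Gamma> j i k"
    and met: "\<And>i j m. pderiv_at g y i $ j $ m =
      (\<Sum>k\<in>UNIV. g y $ m $ k * \<Gamma> i j k) + (\<Sum>k\<in>UNIV. g y $ j $ k * \<Gamma> i m k)"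
  shows "\<Gamma> i j k = christoffel g y i j k"
proof -
  have "g y *v (\<chi> k. \<Gamma> i j k) = g y *v (\<chi> k. christoffel g y i j k)"
  proof -
    have "(\<Sum>k\<in>UNIV. g y $ m $ k * \<Gamma> i j k) = (\<Sum>k\<in>UNIV. g y $ m $ k * christoffel g y i j k)" for m
      unfolding christoffel_lower[where g = g and y = y, OF G] met
      by (simp add: sym[of j i] sym[of m])
    then show ?thesis by (simp add: matrix_vector_mult_def)
  qed
  then have "matrix_inv (g y) *v (g y *v (\<chi> k. \<Gamma> i j k)) =
      matrix_inv (g y) *v (g y *v (\<chi> k. christoffel g y i j k))"
    by simp
  then have "(\<chi> k. \<Gamma> i j k) = (\<chi> k. christoffel g y i j k)"
    using G by (simp add: matrix_vector_mul_assoc inner_product_matrix_inverse)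
  then show ?thesis by (simp add: vec_eq_iff)
qed

end

theory Submission
  imports Defs
begin

text \<open>The identity is pointwise and local, so everything takes place in one chart. Let \<open>h = g\<^sup>-\<^sup>1 g'\<close>, where a
  prime is the time derivative, and \<open>B u = \<nabla>\<^sub>u h\<close>. The hypothesis \<open>g' \<in> F\<close> says \<open>B u v = B v u\<close>; since \<open>h\<close> is
  self-adjoint, the cubic form \<open>g (B u v) w\<close> is then totally symmetric. Covariant
  derivatives are never commuted, so no curvature term arises.

  Differentiating the torsion-freeness and the metric compatibility of the Levi-Civita connection in time
  shows that \<open>\<Gamma>' u - B u / 2\<close> is symmetric in its two arguments and skew for \<open>g\<close>, hence zero
  (\<open>connection_variation\<close>, from \<open>symmetric_antisymmetric_zero\<close>). Jacobi's formula gives \<open>f' = tr h / 2\<close>, and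
  the gradient of \<open>tr h\<close> is the divergence \<open>D = tr\<^sub>g B\<close> by total symmetry (\<open>grad_trace\<close>). Time and space
  derivatives commute (\<open>dt_frechet_derivative\<close>), so with \<open>N = \<nabla>\<nabla>f\<close> one obtains
  \<open>N' = \<nabla>D / 2 - \<nabla>\<^bsub>\<nabla>f\<^esub> h / 2 - h N\<close> (\<open>hessian_variation\<close>).

  Two facts bring in the complex structure. Differentiating the skewness of \<open>J\<close> with respect to \<open>g\<close>, and using
  that \<open>J'\<close> is self-adjoint, gives \<open>2 J' = J h - h J\<close> (\<open>complex_structure_variation\<close>). And
  the adjoint of the Dolbeault operator applied to the anti-linear part of \<open>h\<close> is exactly \<open>- D / 2\<close>: the terms
  in which \<open>J\<close> acts on one argument cancel and those in which it acts on both agree with those without \<open>J\<close>,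
  since the metric trace is symmetric and invariant under \<open>J\<close> (\<open>metric_trace_part01\<close>). So the
  term \<open>\<nabla>D\<close> becomes the Dolbeault term of the formula, and expanding the derivative of \<open>N + J N J\<close>
  leaves an identity between matrices (\<open>kaehler_variation_algebra\<close>).

  All of this is carried out for matrix-valued functions of time and of a point of the chart that are jointly
  smooth. The calculus of smooth maps needed for this is developed from the definition by iterated
  directional derivatives.\<close>

section \<open>Iterated directional derivatives\<close>

lemma Ck_on_cong:
  fixes f f' :: "'a::real_normed_vector \<Rightarrow> 'b::real_normed_vector"
  assumes "open S" "\<And>x. x \<in> S \<Longrightarrow> f x = f' x" "Ck_on k S f"
  shows "Ck_on k S f'"
  using assms(2,3)
proof (induction k arbitrary: f f')
  case 0
  then show ?case by (auto intro: continuous_on_eq)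
next
  case (Suc k)
  have d: "f' differentiable (at x)" "frechet_derivative f' (at x) = frechet_derivative f (at x)"
    if "x \<in> S" for x
  proof -
    have "(f has_derivative frechet_derivative f (at x)) (at x)"
      using Suc.prems(2) that frechet_derivative_works by auto
    then have "(f' has_derivative frechet_derivative f (at x)) (at x)"
      by (rule has_derivative_transform_within_open[OF _ assms(1) that]) (simp add: Suc.prems(1))
    then show "f' differentiable (at x)" "frechet_derivative f' (at x) = frechet_derivative f (at x)"
      by (auto simp: differentiable_def frechet_derivative_at[symmetric])
  qed
  have "Ck_on k S (\<lambda>x. frechet_derivative f' (at x) v)" for v
    by (rule Suc.IH[of "\<lambda>x. frechet_derivative f (at x) v"]) (use Suc.prems(2) d in auto)
  then show ?case using d by simp
qed

text \<open>The form in which an order of differentiability is gained: any family of maps which is known to be the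
  derivative pointwise may stand in for the Frechet derivative.\<close>

lemma Ck_on_SucI:
  assumes "open S" "\<And>x. x \<in> S \<Longrightarrow> (f has_derivative f' x) (at x)"
    "\<And>v. Ck_on k S (\<lambda>x. f' x v)"
  shows "Ck_on (Suc k) S f"
proof -
  have "Ck_on k S (\<lambda>x. frechet_derivative f (at x) v)" for v
    by (rule Ck_on_cong[OF assms(1) _ assms(3)[of v]])
       (use assms(2) frechet_derivative_at in fastforce)
  then show ?thesis using assms(2) by (auto simp: differentiable_def)
qed

lemma Ck_on_has_derivative:
  "Ck_on (Suc k) S f \<Longrightarrow> x \<in> S \<Longrightarrow> (f has_derivative frechet_derivative f (at x)) (at x)"
  using frechet_derivative_works by auto

lemma Ck_on_SucD: "Ck_on (Suc k) S f \<Longrightarrow> Ck_on k S f"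
proof (induction k arbitrary: f)
  case 0
  then show ?case
    by (auto intro!: continuous_at_imp_continuous_on differentiable_imp_continuous_within)
next
  case (Suc k)
  then show ?case by simp
qed

lemma smooth_on_has_derivative:
  "smooth_on S f \<Longrightarrow> x \<in> S \<Longrightarrow> (f has_derivative frechet_derivative f (at x)) (at x)"
  unfolding smooth_on_def using Ck_on_has_derivative by blast

lemma smooth_on_frechet_derivative:
  "smooth_on S f \<Longrightarrow> smooth_on S (\<lambda>x. frechet_derivative f (at x) v)"
  unfolding smooth_on_def by (metis Ck_on.simps(2))

lemma smooth_onI:
  assumes "open S" "\<And>x. x \<in> S \<Longrightarrow> (f has_derivative f' x) (at x)"
    "\<And>v. smooth_on S (\<lambda>x. f' x v)"
  shows "smooth_on S f"
  unfolding smooth_on_def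
proof
  fix k
  show "Ck_on k S f"
    using Ck_on_SucD[OF Ck_on_SucI[OF assms(1,2)]] assms(3) unfolding smooth_on_def by blast
qed

lemma smooth_on_cong:
  "open S \<Longrightarrow> (\<And>x. x \<in> S \<Longrightarrow> f x = f' x) \<Longrightarrow> smooth_on S f \<Longrightarrow> smooth_on S f'"
  unfolding smooth_on_def using Ck_on_cong by blast

lemma Ck_on_const: "Ck_on k S (\<lambda>x. c)"
  by (induction k arbitrary: c) simp_all

lemma Ck_on_add:
  assumes "open S" "Ck_on k S f" "Ck_on k S f'"
  shows "Ck_on k S (\<lambda>x. f x + f' x)"
  using assms(2,3)
proof (induction k arbitrary: f f')
  case 0
  then show ?case by (auto intro: continuous_on_add)
next
  case (Suc k)
  show ?case
    by (rule Ck_on_SucI[OF assms(1)], rule has_derivative_add)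
       (use Suc in \<open>auto intro!: Suc.IH simp: frechet_derivative_works\<close>)
qed

lemma Ck_on_bilinear:
  assumes "open S" "bounded_bilinear B" "Ck_on k S f" "Ck_on k S f'"
  shows "Ck_on k S (\<lambda>x. B (f x) (f' x))"
  using assms(3,4)
proof (induction k arbitrary: f f')
  case 0
  then show ?case using bounded_bilinear.continuous_on[OF assms(2)] by auto
next
  case (Suc k)
  show ?case
  proof (rule Ck_on_SucI[OF assms(1)])
    show "((\<lambda>x. B (f x) (f' x)) has_derivative (\<lambda>v. B (f x) (frechet_derivative f' (at x) v) +
        B (frechet_derivative f (at x) v) (f' x))) (at x)" if "x \<in> S" for x
      by (rule bounded_bilinear.FDERIV[OF assms(2) Ck_on_has_derivative Ck_on_has_derivative])
         (use Suc.prems that in auto)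
    show "Ck_on k S (\<lambda>x. B (f x) (frechet_derivative f' (at x) v) +
        B (frechet_derivative f (at x) v) (f' x))" for v
      by (intro Ck_on_add[OF assms(1)] Suc.IH Ck_on_SucD[OF Suc.prems(1)] Ck_on_SucD[OF Suc.prems(2)])
         (use Suc.prems in simp_all)
  qed
qed

text \<open>Affine substitutions are all the compositions needed: restricting to a time slice, and regarding a function
  of space as constant in time.\<close>

lemma Ck_on_affine:
  assumes "open S" "bounded_linear L" "\<And>x. x \<in> S \<Longrightarrow> c + L x \<in> S'" "Ck_on k S' f"
  shows "Ck_on k S (\<lambda>x. f (c + L x))"
  using assms(4)
proof (induction k arbitrary: f)
  case 0
  have "continuous_on S (\<lambda>x. c + L x)"
    using assms(2) by (intro continuous_intros bounded_linear.continuous_on[OF assms(2)])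
  then show ?case using 0 assms(3)
    by (auto intro!: continuous_on_compose2[of S' f S "\<lambda>x. c + L x"])
next
  case (Suc k)
  have L: "((\<lambda>x. c + L x) has_derivative L) (at x)" for x
    using has_derivative_add[OF has_derivative_const bounded_linear_imp_has_derivative[OF assms(2)]]
    by simp
  show ?case
  proof (rule Ck_on_SucI[OF assms(1)])
    fix x assume "x \<in> S"
    then have "(f has_derivative frechet_derivative f (at (c + L x))) (at (c + L x))"
      using Suc.prems assms(3) Ck_on_has_derivative by blast
    then show "((\<lambda>x. f (c + L x)) has_derivative
        (\<lambda>v. frechet_derivative f (at (c + L x)) (L v))) (at x)"
      using has_derivative_compose[OF L] by blast
  next
    fix v
    show "Ck_on k S (\<lambda>x. frechet_derivative f (at (c + L x)) (L v))"
      by (rule Suc.IH) (use Suc.prems in simp)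
  qed
qed

lemma smooth_on_const: "smooth_on S (\<lambda>x. c)"
  by (simp add: smooth_on_def Ck_on_const)

lemma smooth_on_add:
  "open S \<Longrightarrow> smooth_on S f \<Longrightarrow> smooth_on S f' \<Longrightarrow> smooth_on S (\<lambda>x. f x + f' x)"
  by (simp add: smooth_on_def Ck_on_add)

lemma smooth_on_bilinear:
  "bounded_bilinear B \<Longrightarrow> open S \<Longrightarrow> smooth_on S f \<Longrightarrow> smooth_on S f' \<Longrightarrow>
     smooth_on S (\<lambda>x. B (f x) (f' x))"
  by (simp add: smooth_on_def Ck_on_bilinear)

lemma smooth_on_affine:
  assumes "open S" "bounded_linear L" "\<And>x. x \<in> S \<Longrightarrow> c + L x \<in> S'" "smooth_on S' f"
  shows "smooth_on S (\<lambda>x. f (c + L x))"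
  using assms(4) unfolding smooth_on_def by (intro allI Ck_on_affine[OF assms(1,2,3)]) simp_all

lemma smooth_on_linear:
  assumes "bounded_linear L" "open S" "smooth_on S f"
  shows "smooth_on S (\<lambda>x. L (f x))"
proof -
  have "bounded_bilinear (\<lambda>(r::real) z. r *\<^sub>R L z)"
    by (rule bounded_bilinear.comp[OF bounded_bilinear_scaleR bounded_linear_ident assms(1)])
  from smooth_on_bilinear[OF this assms(2) smooth_on_const[of S 1] assms(3)]
  show ?thesis by simp
qed

lemma smooth_on_sum:
  assumes "open S" "\<And>i. i \<in> I \<Longrightarrow> smooth_on S (f i)"
  shows "smooth_on S (\<lambda>x. \<Sum>i\<in>I. f i x)"
  using assms(2)
  by (induction I rule: infinite_finite_induct)
     (auto intro!: smooth_on_const smooth_on_add assms(1))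

text \<open>A bootstrap for maps that satisfy a differential equation of the type of \<open>(u\<^sup>-\<^sup>1)' = - u\<^sup>-\<^sup>1 u' u\<^sup>-\<^sup>1\<close>: the
  right-hand side is as regular as \<open>f\<close> itself, so each order of differentiability yields the next. It covers
  the inverse of a number and of a matrix, without any explicit formula for the inverse.\<close>

lemma smooth_on_riccati:
  assumes "open S" "bounded_bilinear B" "bounded_bilinear C" "smooth_on S u"
    and d: "\<And>x. x \<in> S \<Longrightarrow>
      (f has_derivative (\<lambda>v. B (f x) (C (frechet_derivative u (at x) v) (f x)))) (at x)"
  shows "smooth_on S f"
proof -
  have "Ck_on k S f" for k
  proof (induction k)
    case 0
    have "continuous_on S f"
      using d by (meson continuous_at_imp_continuous_on has_derivative_continuous)
    then show ?case by simp
  next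
    case (Suc k)
    have u: "Ck_on k S (\<lambda>x. frechet_derivative u (at x) v)" for v
      using smooth_on_frechet_derivative[OF assms(4)] unfolding smooth_on_def by blast
    show ?case
      by (rule Ck_on_SucI[OF assms(1) d], assumption)
         (rule Ck_on_bilinear[OF assms(1,2) Suc.IH Ck_on_bilinear[OF assms(1,3) u Suc.IH]])
  qed
  then show ?thesis by (simp add: smooth_on_def)
qed

lemma smooth_on_inverse:
  fixes u :: "'a::real_normed_vector \<Rightarrow> real"
  assumes "open S" "smooth_on S u" "\<And>x. x \<in> S \<Longrightarrow> u x \<noteq> 0"
  shows "smooth_on S (\<lambda>x. inverse (u x))"
proof (rule smooth_on_riccati[OF assms(1) _ bounded_bilinear_mult assms(2)])
  show "bounded_bilinear (\<lambda>a b::real. - (a * b))"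
    using bounded_bilinear.comp[OF bounded_bilinear_mult bounded_linear_minus[OF bounded_linear_ident]
        bounded_linear_ident] by simp
  fix x assume "x \<in> S"
  then show "((\<lambda>x. inverse (u x)) has_derivative
      (\<lambda>v. - (inverse (u x) * (frechet_derivative u (at x) v * inverse (u x))))) (at x)"
    using Deriv.has_derivative_inverse[OF assms(3) smooth_on_has_derivative[OF assms(2)]]
    by (simp add: mult.assoc)
qed

section \<open>Symmetry of second derivatives\<close>

text \<open>The mean value theorem applied first along \<open>u\<close> to a difference in the direction \<open>v\<close>, then along \<open>v\<close>. The
  left-hand side is symmetric in \<open>u\<close> and \<open>v\<close>, which is the source of the symmetry of second derivatives.\<close>

lemma double_difference:
  fixes \<phi> :: "'a::real_normed_vector \<Rightarrow> real"
  assumes s: "s > 0"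
    and seg: "\<And>a b. a \<in> {0..s} \<Longrightarrow> b \<in> {0..s} \<Longrightarrow> x + a *\<^sub>R u + b *\<^sub>R v \<in> S"
    and d1: "\<And>z. z \<in> S \<Longrightarrow> (\<phi> has_derivative D z) (at z)"
    and d2: "\<And>z. z \<in> S \<Longrightarrow> ((\<lambda>w. D w u) has_derivative E z) (at z)"
  shows "\<exists>a\<in>{0..s}. \<exists>b\<in>{0..s}. \<phi> (x + s *\<^sub>R u + s *\<^sub>R v) - \<phi> (x + s *\<^sub>R u) - \<phi> (x + s *\<^sub>R v) + \<phi> x
      = s\<^sup>2 * E (x + a *\<^sub>R u + b *\<^sub>R v) v"
proof -
  have Dlin: "D z (r *\<^sub>R w) = r * D z w" if "z \<in> S" for z r w
    using has_derivative_linear[OF d1[OF that]] by (simp add: linear_scale)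
  have Elin: "E z (r *\<^sub>R w) = r * E z w" if "z \<in> S" for z r w
    using has_derivative_linear[OF d2[OF that]] by (simp add: linear_scale)
  define k where "k a = \<phi> (x + a *\<^sub>R u + s *\<^sub>R v) - \<phi> (x + a *\<^sub>R u + 0 *\<^sub>R v)" for a
  have line: "((\<lambda>a. x + a *\<^sub>R u + b *\<^sub>R v) has_derivative (\<lambda>r. r *\<^sub>R u)) F" for b and F :: "real filter"
    by (auto intro!: derivative_eq_intros)
  have "\<exists>a\<in>{0<..<s}. k s - k 0 =
      (\<lambda>r. D (x + a *\<^sub>R u + s *\<^sub>R v) (r *\<^sub>R u) - D (x + a *\<^sub>R u + 0 *\<^sub>R v) (r *\<^sub>R u)) (s - 0)"
    unfolding k_def
    by (rule mvt_simple[OF s], rule has_derivative_diff;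
        rule has_derivative_compose[OF line d1]; rule seg; use s in simp)
  then obtain a where a0: "a \<in> {0<..<s}" and ka:
    "k s - k 0 = D (x + a *\<^sub>R u + s *\<^sub>R v) ((s - 0) *\<^sub>R u) - D (x + a *\<^sub>R u + 0 *\<^sub>R v) ((s - 0) *\<^sub>R u)"
    by blast
  have a: "a \<in> {0..s}" using a0 by simp
  have ka': "k s - k 0 = s * (D (x + a *\<^sub>R u + s *\<^sub>R v) u - D (x + a *\<^sub>R u + 0 *\<^sub>R v) u)"
    unfolding ka using Dlin[OF seg[OF a]] s by (simp add: right_diff_distrib del: scaleR_zero_left)
  have line2: "((\<lambda>b. x + a *\<^sub>R u + b *\<^sub>R v) has_derivative (\<lambda>r. r *\<^sub>R v)) F" for F :: "real filter"
    by (auto intro!: derivative_eq_intros)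
  have "\<exists>b\<in>{0<..<s}. D (x + a *\<^sub>R u + s *\<^sub>R v) u - D (x + a *\<^sub>R u + 0 *\<^sub>R v) u =
      (\<lambda>r. E (x + a *\<^sub>R u + b *\<^sub>R v) (r *\<^sub>R v)) (s - 0)"
    by (rule mvt_simple[OF s], rule has_derivative_compose[OF line2 d2], rule seg[OF a], simp)
  then obtain b where b0: "b \<in> {0<..<s}" and kb: "D (x + a *\<^sub>R u + s *\<^sub>R v) u - D (x + a *\<^sub>R u + 0 *\<^sub>R v) u
      = E (x + a *\<^sub>R u + b *\<^sub>R v) ((s - 0) *\<^sub>R v)"
    by blast
  have b: "b \<in> {0..s}" using b0 by simp
  have "k s - k 0 = s\<^sup>2 * E (x + a *\<^sub>R u + b *\<^sub>R v) v"
    unfolding ka' kb Elin[OF seg[OF a b]] by (simp add: power2_eq_square)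
  then show ?thesis using a b unfolding k_def
    by (intro bexI[of _ a] bexI[of _ b]) (simp_all add: algebra_simps)
qed

text \<open>If the two values differed, continuity would keep the mixed second derivatives apart near \<open>x\<close>, whereas
  on every small parallelogram some value of the one equals some value of the other.\<close>

lemma symmetric_derivative_real:
  fixes \<phi> :: "'a::real_normed_vector \<Rightarrow> real"
  assumes S: "open S" "x \<in> S"
    and d: "\<And>z. z \<in> S \<Longrightarrow> (\<phi> has_derivative D z) (at z)"
    and du: "\<And>z. z \<in> S \<Longrightarrow> ((\<lambda>w. D w u) has_derivative E z) (at z)"
    and dv: "\<And>z. z \<in> S \<Longrightarrow> ((\<lambda>w. D w v) has_derivative E' z) (at z)"
    and c: "continuous_on S (\<lambda>z. E z v)" "continuous_on S (\<lambda>z. E' z u)"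
  shows "E x v = E' x u"
proof (rule ccontr)
  assume ne: "E x v \<noteq> E' x u"
  define e where "e = \<bar>E x v - E' x u\<bar> / 2"
  have e: "e > 0" using ne by (simp add: e_def)
  have c': "isCont (\<lambda>z. E z v) x" "isCont (\<lambda>z. E' z u) x"
    using c S continuous_on_eq_continuous_at by blast+
  obtain r0 where r0: "r0 > 0" "\<And>z. dist z x < r0 \<Longrightarrow> z \<in> S"
    using S unfolding open_dist by blast
  obtain r1 where r1: "r1 > 0" "\<And>z. dist z x < r1 \<Longrightarrow> dist (E z v) (E x v) < e"
    using c'(1) e unfolding continuous_at_eps_delta by blast
  obtain r2 where r2: "r2 > 0" "\<And>z. dist z x < r2 \<Longrightarrow> dist (E' z u) (E' x u) < e"
    using c'(2) e unfolding continuous_at_eps_delta by blast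
  define r where "r = min r0 (min r1 r2)"
  \<comment> \<open>The parallelogram with sides \<open>s u\<close>, \<open>s v\<close> stays within distance \<open>r\<close> of \<open>x\<close>; the summand 1
      only avoids a division by zero.\<close>
  define s where "s = r / (2 * (norm u + norm v + 1))"
  have r: "r > 0" using r0 r1 r2 by (simp add: r_def)
  have pos: "norm u + norm v + 1 > 0"
    using norm_ge_zero[of u] norm_ge_zero[of v] by linarith
  have s: "s > 0" using r pos by (simp add: s_def)
  have near: "dist (x + a *\<^sub>R u + b *\<^sub>R v) x < r" if "a \<in> {0..s}" "b \<in> {0..s}" for a b
  proof -
    have "dist (x + a *\<^sub>R u + b *\<^sub>R v) x \<le> norm (a *\<^sub>R u) + norm (b *\<^sub>R v)"
      by (simp add: dist_norm add.assoc norm_triangle_ineq del: norm_scaleR)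
    also have "\<dots> \<le> s * norm u + s * norm v"
      using that by (auto intro!: add_mono mult_right_mono)
    also have "\<dots> < 2 * (s * (norm u + norm v + 1))"
      using s by (simp add: algebra_simps add_nonneg_pos)
    also have "\<dots> = r"
    proof -
      have "2 * (r / (2 * c) * c) = r" if "c > 0" for c :: real using that by simp
      then show ?thesis unfolding s_def using pos by blast
    qed
    finally show ?thesis .
  qed
  have near': "dist (x + a *\<^sub>R v + b *\<^sub>R u) x < r" if "a \<in> {0..s}" "b \<in> {0..s}" for a b
    using near[OF that(2,1)] by (simp add: add_ac)
  obtain a b where ab: "a \<in> {0..s}" "b \<in> {0..s}" and
    1: "\<phi> (x + s *\<^sub>R u + s *\<^sub>R v) - \<phi> (x + s *\<^sub>R u) - \<phi> (x + s *\<^sub>R v) + \<phi> x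
      = s\<^sup>2 * E (x + a *\<^sub>R u + b *\<^sub>R v) v"
    using double_difference[OF s _ d du, of x v] near r0(2) unfolding r_def by (metis min_less_iff_conj)
  obtain a' b' where ab': "a' \<in> {0..s}" "b' \<in> {0..s}" and
    2: "\<phi> (x + s *\<^sub>R v + s *\<^sub>R u) - \<phi> (x + s *\<^sub>R v) - \<phi> (x + s *\<^sub>R u) + \<phi> x
      = s\<^sup>2 * E' (x + a' *\<^sub>R v + b' *\<^sub>R u) u"
    using double_difference[OF s _ d dv, of x u] near' r0(2) unfolding r_def by (metis min_less_iff_conj)
  have swap: "x + s *\<^sub>R v + s *\<^sub>R u = x + s *\<^sub>R u + s *\<^sub>R v"
    by (simp add: add_ac)
  have "s\<^sup>2 * E (x + a *\<^sub>R u + b *\<^sub>R v) v = s\<^sup>2 * E' (x + a' *\<^sub>R v + b' *\<^sub>R u) u"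
    unfolding 1[symmetric] 2[symmetric] swap by simp
  then have eq: "E (x + a *\<^sub>R u + b *\<^sub>R v) v = E' (x + a' *\<^sub>R v + b' *\<^sub>R u) u"
    using s by simp
  have "dist (E (x + a *\<^sub>R u + b *\<^sub>R v) v) (E x v) < e"
    "dist (E' (x + a' *\<^sub>R v + b' *\<^sub>R u) u) (E' x u) < e"
    using near[OF ab] near'[OF ab'] r1 r2 by (auto simp: r_def)
  then show False
    unfolding eq e_def dist_real_def by argo
qed

lemma symmetric_derivative:
  fixes f :: "'a::real_normed_vector \<Rightarrow> 'b::euclidean_space"
  assumes "open S" "x \<in> S" "smooth_on S f"
  shows "frechet_derivative (\<lambda>z. frechet_derivative f (at z) u) (at x) v =
         frechet_derivative (\<lambda>z. frechet_derivative f (at z) v) (at x) u"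
proof (rule euclidean_eqI)
  fix i :: 'b assume "i \<in> Basis"
  note i = has_derivative_inner_left
  let ?D = "\<lambda>z. frechet_derivative f (at z)"
  let ?E = "\<lambda>u z. frechet_derivative (\<lambda>z. ?D z u) (at z)"
  have cont: "continuous_on S (\<lambda>z. ?E u z v \<bullet> i)" for u v
  proof -
    have "Ck_on 0 S (\<lambda>z. ?E u z v)"
      using smooth_on_frechet_derivative[OF smooth_on_frechet_derivative[OF assms(3)]]
      unfolding smooth_on_def by blast
    then show ?thesis by (auto intro!: continuous_intros)
  qed
  have d: "((\<lambda>z. f z \<bullet> i) has_derivative (\<lambda>v. ?D z v \<bullet> i)) (at z)" if "z \<in> S" for z
    by (rule i[OF smooth_on_has_derivative[OF assms(3) that]])
  have d2: "((\<lambda>z. ?D z u \<bullet> i) has_derivative (\<lambda>v. ?E u z v \<bullet> i)) (at z)" if "z \<in> S" for z u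
    by (rule i[OF smooth_on_has_derivative[OF smooth_on_frechet_derivative[OF assms(3)] that]])
  show "?E u x v \<bullet> i = ?E v x u \<bullet> i"
    by (rule symmetric_derivative_real[OF assms(1,2) d d2 d2 cont cont])
qed

section \<open>Smooth families depending on time\<close>

text \<open>Joint smoothness in time and space, curried, so that slices and partial derivatives are again
  curried functions and closure rules apply by matching on \<open>\<lambda>t y. \<dots>\<close>.\<close>

definition smooth_family ::
  "real set \<Rightarrow> 'a set \<Rightarrow> (real \<Rightarrow> 'a::real_normed_vector \<Rightarrow> 'b::real_normed_vector) \<Rightarrow> bool" where
  "smooth_family T U \<Phi> \<longleftrightarrow> smooth_on (T \<times> U) (\<lambda>p. \<Phi> (fst p) (snd p))"

definition dt :: "(real \<Rightarrow> 'a \<Rightarrow> 'b::real_normed_vector) \<Rightarrow> real \<Rightarrow> 'a \<Rightarrow> 'b" where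
  "dt \<Phi> t y = vector_derivative (\<lambda>s. \<Phi> s y) (at t)"

text \<open>Both partial derivatives are restrictions of the total derivative on the product; this reduces every
  statement about a family to one about a single smooth map.\<close>

lemma smooth_family_partials:
  assumes "smooth_family T U \<Phi>" "t \<in> T" "y \<in> U"
  shows "(\<Phi> t has_derivative (\<lambda>v. frechet_derivative (\<lambda>p. \<Phi> (fst p) (snd p)) (at (t, y)) (0, v))) (at y)"
    and "((\<lambda>s. \<Phi> s y) has_vector_derivative
      frechet_derivative (\<lambda>p. \<Phi> (fst p) (snd p)) (at (t, y)) (1, 0)) (at t)"
proof -
  let ?D = "frechet_derivative (\<lambda>p. \<Phi> (fst p) (snd p)) (at (t, y))"
  have D: "((\<lambda>p. \<Phi> (fst p) (snd p)) has_derivative ?D) (at (t, y))"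
    using smooth_on_has_derivative assms unfolding smooth_family_def by blast
  have 1: "((\<lambda>z. (t, z)) has_derivative (\<lambda>v. (0, v))) (at y)"
    by (auto intro!: derivative_eq_intros)
  have 2: "((\<lambda>s. (s, y)) has_derivative (\<lambda>r. (r, 0))) (at t)"
    by (auto intro!: derivative_eq_intros)
  show "(\<Phi> t has_derivative (\<lambda>v. ?D (0, v))) (at y)"
    using has_derivative_compose[OF 1 D] by simp
  have "(\<lambda>r. ?D (r, 0)) = (\<lambda>r. r *\<^sub>R ?D (1, 0))"
  proof
    fix r show "?D (r, 0) = r *\<^sub>R ?D (1, 0)"
      using linear_scale[OF has_derivative_linear[OF D], of r "(1, 0)"] by simp
  qed
  then show "((\<lambda>s. \<Phi> s y) has_vector_derivative ?D (1, 0)) (at t)"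
    using has_derivative_compose[OF 2 D] unfolding has_vector_derivative_def by simp
qed

lemma smooth_family_space:
  assumes "smooth_family T U \<Phi>" "t \<in> T" "y \<in> U"
  shows "(\<Phi> t has_derivative frechet_derivative (\<Phi> t) (at y)) (at y)"
    and "frechet_derivative (\<Phi> t) (at y) v = frechet_derivative (\<lambda>p. \<Phi> (fst p) (snd p)) (at (t, y)) (0, v)"
  using smooth_family_partials(1)[OF assms] by (auto simp: frechet_derivative_at[symmetric])

lemma smooth_family_time:
  assumes "smooth_family T U \<Phi>" "t \<in> T" "y \<in> U"
  shows "((\<lambda>s. \<Phi> s y) has_vector_derivative dt \<Phi> t y) (at t)"
    and "dt \<Phi> t y = frechet_derivative (\<lambda>p. \<Phi> (fst p) (snd p)) (at (t, y)) (1, 0)"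
  using smooth_family_partials(2)[OF assms] by (auto simp: dt_def vector_derivative_at)

lemma smooth_family_cong:
  assumes "open T" "open U" "\<And>t y. t \<in> T \<Longrightarrow> y \<in> U \<Longrightarrow> \<Phi> t y = \<Psi> t y" "smooth_family T U \<Phi>"
  shows "smooth_family T U \<Psi>"
  unfolding smooth_family_def
  by (rule smooth_on_cong[OF open_Times[OF assms(1,2)] _ assms(4)[unfolded smooth_family_def]])
     (use assms(3) in auto)

lemma smooth_family_frechet_derivative:
  assumes "open T" "open U" "smooth_family T U \<Phi>"
  shows "smooth_family T U (\<lambda>t y. frechet_derivative (\<Phi> t) (at y) v)"
proof (rule smooth_family_cong[OF assms(1,2)])
  show "smooth_family T U (\<lambda>t y. frechet_derivative (\<lambda>p. \<Phi> (fst p) (snd p)) (at (t, y)) (0, v))"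
    unfolding smooth_family_def prod.collapse
    by (rule smooth_on_frechet_derivative[OF assms(3)[unfolded smooth_family_def]])
  fix t y assume "t \<in> T" "y \<in> U"
  from smooth_family_space(2)[OF assms(3) this]
  show "frechet_derivative (\<lambda>p. \<Phi> (fst p) (snd p)) (at (t, y)) (0, v) = frechet_derivative (\<Phi> t) (at y) v" ..
qed

lemma smooth_family_dt:
  assumes "open T" "open U" "smooth_family T U \<Phi>"
  shows "smooth_family T U (dt \<Phi>)"
proof (rule smooth_family_cong[OF assms(1,2)])
  show "smooth_family T U (\<lambda>t y. frechet_derivative (\<lambda>p. \<Phi> (fst p) (snd p)) (at (t, y)) (1, 0))"
    unfolding smooth_family_def prod.collapse
    by (rule smooth_on_frechet_derivative[OF assms(3)[unfolded smooth_family_def]])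
  fix t y assume "t \<in> T" "y \<in> U"
  from smooth_family_time(2)[OF assms(3) this]
  show "frechet_derivative (\<lambda>p. \<Phi> (fst p) (snd p)) (at (t, y)) (1, 0) = dt \<Phi> t y" ..
qed

lemma smooth_family_const: "smooth_family T U (\<lambda>t y. c)"
  by (simp add: smooth_family_def smooth_on_const)

lemma smooth_family_static:
  assumes "open T" "open U" "smooth_on U f"
  shows "smooth_family T U (\<lambda>t. f)"
proof -
  have "smooth_on (T \<times> U) (\<lambda>p. f (0 + snd p))"
    by (rule smooth_on_affine[OF open_Times[OF assms(1,2)] bounded_linear_snd _ assms(3)]) auto
  then show ?thesis by (simp add: smooth_family_def)
qed

lemma smooth_family_add:
  assumes "open T" "open U" "smooth_family T U \<Phi>" "smooth_family T U \<Psi>"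
  shows "smooth_family T U (\<lambda>t y. \<Phi> t y + \<Psi> t y)"
  using smooth_on_add[OF open_Times[OF assms(1,2)] assms(3,4)[unfolded smooth_family_def]]
  by (simp only: smooth_family_def)

lemma smooth_family_bilinear:
  assumes "bounded_bilinear B" "open T" "open U" "smooth_family T U \<Phi>" "smooth_family T U \<Psi>"
  shows "smooth_family T U (\<lambda>t y. B (\<Phi> t y) (\<Psi> t y))"
  using smooth_on_bilinear[OF assms(1) open_Times[OF assms(2,3)] assms(4,5)[unfolded smooth_family_def]]
  by (simp only: smooth_family_def)

lemma smooth_family_linear:
  assumes "bounded_linear L" "open T" "open U" "smooth_family T U \<Phi>"
  shows "smooth_family T U (\<lambda>t y. L (\<Phi> t y))"
  using smooth_on_linear[OF assms(1) open_Times[OF assms(2,3)] assms(4)[unfolded smooth_family_def]]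
  by (simp only: smooth_family_def)

lemma smooth_family_sum:
  assumes "open T" "open U" "\<And>i. i \<in> I \<Longrightarrow> smooth_family T U (\<Phi> i)"
  shows "smooth_family T U (\<lambda>t y. \<Sum>i\<in>I. \<Phi> i t y)"
  using smooth_on_sum[OF open_Times[OF assms(1,2)] assms(3)[unfolded smooth_family_def]]
  by (simp only: smooth_family_def)

text \<open>Symmetry of second derivatives in the directions \<open>(1, 0)\<close> and \<open>(0, v)\<close>.\<close>

lemma dt_frechet_derivative:
  fixes \<Phi> :: "real \<Rightarrow> 'a::real_normed_vector \<Rightarrow> 'b::euclidean_space"
  assumes "open T" "open U" "smooth_family T U \<Phi>" "t \<in> T" "y \<in> U"
  shows "((\<lambda>s. frechet_derivative (\<Phi> s) (at y) v) has_vector_derivative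
           frechet_derivative (dt \<Phi> t) (at y) v) (at t)"
proof -
  let ?D = "\<lambda>p. frechet_derivative (\<lambda>p. \<Phi> (fst p) (snd p)) (at p)"
  have W: "open (T \<times> U)" "(t, y) \<in> T \<times> U" using open_Times[OF assms(1,2)] assms(4,5) by simp_all
  have D: "smooth_on (T \<times> U) (\<lambda>p. ?D p w)" for w
    by (rule smooth_on_frechet_derivative[OF assms(3)[unfolded smooth_family_def]])
  have Dd: "(\<lambda>p. ?D p w) differentiable (at (t, y))" for w
    using smooth_on_has_derivative[OF D W(2)] unfolding differentiable_def by blast
  have "((\<lambda>s. frechet_derivative (\<Phi> s) (at y) v) has_vector_derivative
      frechet_derivative (\<lambda>p. frechet_derivative (\<Phi> (fst p)) (at (snd p)) v) (at (t, y)) (1, 0)) (at t)"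
    using smooth_family_partials(2)[OF smooth_family_frechet_derivative[OF assms(1,2,3)] assms(4,5)] .
  also have "frechet_derivative (\<lambda>p. frechet_derivative (\<Phi> (fst p)) (at (snd p)) v) (at (t, y)) =
      frechet_derivative (\<lambda>p. ?D p (0, v)) (at (t, y))"
    by (rule frechet_derivative_transform_within_open[symmetric, OF Dd W])
       (auto simp: smooth_family_space(2)[OF assms(3)])
  also have "\<dots> (1, 0) = frechet_derivative (\<lambda>p. ?D p (1, 0)) (at (t, y)) (0, v)"
    by (rule symmetric_derivative[OF W assms(3)[unfolded smooth_family_def]])
  also have "frechet_derivative (\<lambda>p. ?D p (1, 0)) (at (t, y)) =
      frechet_derivative (\<lambda>p. dt \<Phi> (fst p) (snd p)) (at (t, y))"
    by (rule frechet_derivative_transform_within_open[OF Dd W])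
       (auto simp: smooth_family_time(2)[OF assms(3)])
  also have "\<dots> (0, v) = frechet_derivative (dt \<Phi> t) (at y) v"
    by (rule smooth_family_space(2)[OF smooth_family_dt[OF assms(1,2,3)] assms(4,5), symmetric])
  finally show ?thesis .
qed

lemma smooth_family_slice:
  assumes "open U" "smooth_family T U \<Phi>" "t \<in> T"
  shows "smooth_on U (\<Phi> t)"
proof -
  have "smooth_on U (\<lambda>y. \<Phi> (fst ((t, 0) + (0, y))) (snd ((t, 0) + (0, y))))"
    by (rule smooth_on_affine[OF assms(1) _ _ assms(2)[unfolded smooth_family_def]])
       (use assms(3) in \<open>auto intro: bounded_linear_Pair bounded_linear_zero bounded_linear_ident\<close>)
  then show ?thesis by simp
qed

lemma bounded_linear_axis:
  "bounded_linear (axis i :: 'b::euclidean_space \<Rightarrow> 'b^'n::finite)"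
  unfolding linear_conv_bounded_linear[symmetric]
  by (rule linearI) (simp_all add: axis_def vec_eq_iff)

lemma vec_eq_sum_axis: "x = (\<Sum>i\<in>UNIV. axis i ((x::'b::comm_monoid_add^'n::finite) $ i))"
  by (simp add: vec_eq_iff axis_def sum.delta')

lemma smooth_family_vec:
  fixes \<Phi> :: "real \<Rightarrow> 'a::real_normed_vector \<Rightarrow> 'b::euclidean_space^'n::finite"
  assumes "open T" "open U" "\<And>i. smooth_family T U (\<lambda>t y. \<Phi> t y $ i)"
  shows "smooth_family T U \<Phi>"
proof -
  have "smooth_family T U (\<lambda>t y. \<Sum>i\<in>UNIV. axis i (\<Phi> t y $ i))"
    by (rule smooth_family_sum[OF assms(1,2)],
        rule smooth_family_linear[OF bounded_linear_axis assms])
  then show ?thesis by (simp only: vec_eq_sum_axis[symmetric])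
qed

lemma has_vector_derivative_vec:
  fixes \<phi> :: "real \<Rightarrow> 'b::euclidean_space^'n::finite"
  assumes "\<And>i. ((\<lambda>s. \<phi> s $ i) has_vector_derivative \<phi>' $ i) (at t)"
  shows "(\<phi> has_vector_derivative \<phi>') (at t)"
proof -
  have "((\<lambda>s. \<Sum>i\<in>UNIV. axis i (\<phi> s $ i)) has_vector_derivative (\<Sum>i\<in>UNIV. axis i (\<phi>' $ i))) (at t)"
    by (rule has_vector_derivative_sum,
        rule bounded_linear.has_vector_derivative[OF bounded_linear_axis assms])
  then show ?thesis by (simp only: vec_eq_sum_axis[symmetric])
qed

text \<open>How an identity that holds at all times is differentiated: compute the derivative of each side and compare.\<close>

lemma has_vector_derivative_eq:
  assumes "(\<phi> has_vector_derivative a) (at t)" "(\<psi> has_vector_derivative b) (at t)"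
    "open T" "t \<in> T" "\<And>s. s \<in> T \<Longrightarrow> \<phi> s = \<psi> s"
  shows "a = b"
proof -
  have "(\<psi> has_vector_derivative a) (at t)"
    by (rule has_vector_derivative_transform_within_open[OF assms(1,3,4,5)])
  then show ?thesis using assms(2) by (rule vector_derivative_unique_at)
qed

section \<open>Determinant and inverse of a matrix\<close>

lemma bounded_bilinear_matrix_mult:
  "bounded_bilinear ((**) :: real^'k::finite^'m::finite \<Rightarrow> real^'l::finite^'k \<Rightarrow> real^'l^'m)"
  unfolding bilinear_conv_bounded_bilinear[symmetric] bilinear_def
  by (auto intro!: linearI simp: matrix_matrix_mult_def vec_eq_iff algebra_simps sum.distrib sum_distrib_left)

lemma bounded_bilinear_matrix_vector_mult:
  "bounded_bilinear ((*v) :: real^'k::finite^'m::finite \<Rightarrow> real^'k \<Rightarrow> real^'m)"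
  unfolding bilinear_conv_bounded_bilinear[symmetric] bilinear_def
  by (auto intro!: linearI simp: matrix_vector_mult_def vec_eq_iff algebra_simps sum.distrib sum_distrib_left)

lemma bounded_linear_transpose:
  "bounded_linear (transpose :: real^'k::finite^'m::finite \<Rightarrow> real^'m^'k)"
  unfolding linear_conv_bounded_linear[symmetric]
  by (rule linearI) (simp_all add: transpose_def vec_eq_iff)

lemma has_vector_derivative_columns:
  fixes M :: "real \<Rightarrow> real^'n::finite^'n"
  assumes "\<And>v. ((\<lambda>s. M s *v v) has_vector_derivative M' *v v) (at t)"
  shows "(M has_vector_derivative M') (at t)"
proof -
  have c: "transpose B $ j = B *v axis j 1" for B :: "real^'n^'n" and j
    by (simp add: matrix_vector_mult_basis column_def transpose_def)
  have "((\<lambda>s. transpose (M s)) has_vector_derivative transpose M') (at t)"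
    by (rule has_vector_derivative_vec) (simp only: c assms)
  from bounded_linear.has_vector_derivative[OF bounded_linear_transpose this]
  show ?thesis by (simp add: transpose_transpose)
qed

lemma bounded_linear_trace: "bounded_linear (trace :: real^'n::finite^'n \<Rightarrow> real)"
  unfolding linear_conv_bounded_linear[symmetric]
  by (rule linearI) (simp_all add: trace_def sum.distrib sum_distrib_left)

lemmas matrix_mult_expand =
  bounded_bilinear.add_left[OF bounded_bilinear_matrix_mult]
  bounded_bilinear.add_right[OF bounded_bilinear_matrix_mult]
  bounded_bilinear.diff_left[OF bounded_bilinear_matrix_mult]
  bounded_bilinear.diff_right[OF bounded_bilinear_matrix_mult]
  bounded_bilinear.minus_left[OF bounded_bilinear_matrix_mult]
  bounded_bilinear.minus_right[OF bounded_bilinear_matrix_mult]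
  bounded_bilinear.scaleR_left[OF bounded_bilinear_matrix_mult]
  bounded_bilinear.scaleR_right[OF bounded_bilinear_matrix_mult]

lemmas matrix_vector_mult_expand =
  bounded_bilinear.add_left[OF bounded_bilinear_matrix_vector_mult]
  bounded_bilinear.add_right[OF bounded_bilinear_matrix_vector_mult]
  bounded_bilinear.diff_left[OF bounded_bilinear_matrix_vector_mult]
  bounded_bilinear.diff_right[OF bounded_bilinear_matrix_vector_mult]
  bounded_bilinear.minus_left[OF bounded_bilinear_matrix_vector_mult]
  bounded_bilinear.minus_right[OF bounded_bilinear_matrix_vector_mult]
  bounded_bilinear.scaleR_left[OF bounded_bilinear_matrix_vector_mult]
  bounded_bilinear.scaleR_right[OF bounded_bilinear_matrix_vector_mult]

lemma has_derivative_det_permutations: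
  fixes A :: "real^'n::finite^'n"
  shows "(det has_derivative (\<lambda>V. \<Sum>p | p permutes (UNIV::'n set).
     of_int (sign p) * (\<Sum>i\<in>UNIV. V $ i $ p i * (\<Prod>j\<in>UNIV - {i}. A $ j $ p j)))) (at A)"
  unfolding det_def
  by (intro has_derivative_sum has_derivative_mult_right has_derivative_prod
      bounded_linear_imp_has_derivative bounded_linear_compose[OF bounded_linear_vec_nth bounded_linear_vec_nth])

text \<open>In the expansion of the determinant over permutations, the term of a permutation other than the identity
  contains at least two off-diagonal entries, so its derivative at the identity matrix vanishes.\<close>

lemma has_derivative_det_one: "(det has_derivative trace) (at (mat 1 :: real^'n::finite^'n))"
proof -
  have "(\<Sum>p | p permutes (UNIV::'n set). of_int (sign p) *
      (\<Sum>i\<in>UNIV. V $ i $ p i * (\<Prod>j\<in>UNIV - {i}. (mat 1 :: real^'n^'n) $ j $ p j))) = trace V"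
    (is "(\<Sum>p | _. ?F p) = _") for V :: "real^'n^'n"
  proof -
    have z: "?F p = 0" if p: "p permutes UNIV" "p \<noteq> id" for p :: "'n \<Rightarrow> 'n"
    proof -
      have "(\<Prod>j\<in>UNIV - {i}. (mat 1 :: real^'n^'n) $ j $ p j) = 0" for i
      proof -
        obtain k where k: "p k \<noteq> k" using p(2) by (auto simp: fun_eq_iff)
        have "\<exists>j. j \<noteq> i \<and> p j \<noteq> j"
        proof (cases "k = i")
          case True
          then show ?thesis using k p(1) permutes_inj[OF p(1)] by (metis injD)
        qed (use k in blast)
        then obtain j where "j \<in> UNIV - {i}" "(mat 1 :: real^'n^'n) $ j $ p j = 0"
          by (force simp: mat_def)
        then show ?thesis by (intro prod_zero) auto
      qed
      then have "(\<Sum>i\<in>UNIV. V $ i $ p i * (\<Prod>j\<in>UNIV - {i}. (mat 1 :: real^'n^'n) $ j $ p j)) = 0"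
        by (simp only: mult_zero_right sum.neutral_const)
      then show ?thesis by (simp only: mult_zero_right)
    qed
    have "(\<Sum>p | p permutes (UNIV::'n set). ?F p) = (\<Sum>p\<in>{id}. ?F p)"
      by (rule sum.mono_neutral_right) (auto simp: finite_permutations permutes_id z)
    also have "\<dots> = trace V"
      by (simp add: sign_id trace_def mat_def)
    finally show ?thesis .
  qed
  then show ?thesis using has_derivative_det_permutations[of "mat 1 :: real^'n^'n"] by simp
qed

text \<open>Jacobi's formula, obtained from the identity matrix by multiplicativity of the determinant.\<close>

lemma has_derivative_det:
  fixes A :: "real^'n::finite^'n"
  assumes "A ** B = mat 1" "B ** A = mat 1"
  shows "(det has_derivative (\<lambda>V. det A * trace (B ** V))) (at A)"
proof -
  have L: "((\<lambda>V. B ** V) has_derivative (\<lambda>V. B ** V)) (at A)"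
    by (rule bounded_linear_imp_has_derivative[OF bounded_bilinear.bounded_linear_right[OF bounded_bilinear_matrix_mult]])
  have "((\<lambda>V. det (B ** V)) has_derivative (\<lambda>V. trace (B ** V))) (at A)"
    using has_derivative_compose[OF L, of det trace] has_derivative_det_one assms(2) by simp
  then have "((\<lambda>V. det A * det (B ** V)) has_derivative (\<lambda>V. det A * trace (B ** V))) (at A)"
    by (rule has_derivative_mult_right)
  moreover have "det A * det (B ** V) = det V" for V
    by (metis assms(1) det_mul matrix_mul_assoc matrix_mul_lid)
  ultimately show ?thesis by simp
qed

lemma matrix_inv_inverse:
  fixes A :: "real^'n::finite^'n"
  assumes "det A \<noteq> 0"
  shows "A ** matrix_inv A = mat 1" "matrix_inv A ** A = mat 1"
proof -
  have "\<exists>B. A ** B = mat 1 \<and> B ** A = mat 1"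
    using assms by (simp add: invertible_det_nz[symmetric] invertible_def)
  then have "A ** matrix_inv A = mat 1 \<and> matrix_inv A ** A = mat 1"
    unfolding matrix_inv_def by (rule someI_ex)
  then show "A ** matrix_inv A = mat 1" "matrix_inv A ** A = mat 1" by auto
qed

lemma matrix_inv_cramer:
  fixes A :: "real^'n::finite^'n"
  assumes "det A \<noteq> 0"
  shows "matrix_inv A $ k $ j = det (\<chi> i l. if l = k then axis j 1 $ i else A $ i $ l) / det A"
proof -
  have "A *v (matrix_inv A *v axis j 1) = axis j 1"
    by (simp add: matrix_vector_mul_assoc matrix_inv_inverse[OF assms])
  then have "matrix_inv A *v axis j 1 =
      (\<chi> k. det (\<chi> i l. if l = k then axis j 1 $ i else A $ i $ l) / det A)"
    using cramer[OF assms] by blast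
  then have "(matrix_inv A *v axis j 1) $ k =
      det (\<chi> i l. if l = k then axis j 1 $ i else A $ i $ l) / det A"
    by simp
  then show ?thesis
    by (simp add: matrix_vector_mult_def axis_def if_distrib cong: if_cong)
qed

text \<open>By Cramer's rule the entries of the inverse are quotients of determinants. The derivative itself is then
  read off from \<open>B B\<^sup>-\<^sup>1 = 1\<close> in the next lemma, so only differentiability is needed here.\<close>

lemma differentiable_matrix_inv:
  fixes A :: "real^'n::finite^'n"
  assumes "det A \<noteq> 0"
  shows "matrix_inv differentiable (at A)"
proof -
  have det: "det differentiable (at (B::real^'n^'n))" for B
    using has_derivative_det_permutations differentiable_def by blast
  have op: "open {B::real^'n^'n. det B \<noteq> 0}"
  proof -
    have "continuous_on UNIV (det :: real^'n^'n \<Rightarrow> real)"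
      using det by (meson continuous_at_imp_continuous_on differentiable_imp_continuous_within)
    then show ?thesis
      using open_Collect_neq[of det "\<lambda>_. 0"] by (simp add: continuous_on_const)
  qed
  have repl: "(\<lambda>B. det (\<chi> i l. if l = k then axis j 1 $ i else B $ i $ l)) differentiable (at A)"
    for k j :: 'n
  proof -
    have eq: "(\<chi> i l. if l = k then axis j 1 $ i else B $ i $ l) =
        (\<chi> i l. if l = k then axis j 1 $ i else 0) + (\<chi> i l. if l = k then 0 else B $ i $ l)"
      for B :: "real^'n^'n"
      by (simp add: vec_eq_iff)
    have "bounded_linear (\<lambda>B::real^'n^'n. (\<chi> i l. if l = k then 0 else B $ i $ l) :: real^'n^'n)"
      unfolding linear_conv_bounded_linear[symmetric]
      by (rule linearI) (auto simp: vec_eq_iff)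
    then have "(\<lambda>B::real^'n^'n. (\<chi> i l. if l = k then axis j 1 $ i else B $ i $ l) :: real^'n^'n)
        differentiable (at A)"
      unfolding eq
      by (intro differentiable_add differentiable_const bounded_linear_imp_differentiable)
    then show ?thesis
      using differentiable_chain_at[OF _ det] unfolding o_def by blast
  qed
  have "(\<lambda>B. matrix_inv B $ k $ j) differentiable (at A)" for k j
  proof -
    have "(\<lambda>B. det (\<chi> i l. if l = k then axis j 1 $ i else B $ i $ l) / det B) differentiable (at A)"
      using differentiable_divide[OF repl det assms] .
    then obtain D where "((\<lambda>B. det (\<chi> i l. if l = k then axis j 1 $ i else B $ i $ l) / det B)
        has_derivative D) (at A)"
      unfolding differentiable_def by blast
    then have "((\<lambda>B. matrix_inv B $ k $ j) has_derivative D) (at A)"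
      by (rule has_derivative_transform_within_open[OF _ op])
         (use assms in \<open>simp_all add: matrix_inv_cramer\<close>)
    then show ?thesis unfolding differentiable_def by blast
  qed
  then show ?thesis
    by (subst differentiable_componentwise_within)
       (auto simp: Basis_vec_def inner_axis)
qed

lemma has_derivative_matrix_inv:
  fixes A :: "real^'n::finite^'n"
  assumes "det A \<noteq> 0"
  shows "(matrix_inv has_derivative (\<lambda>V. - (matrix_inv A ** (V ** matrix_inv A)))) (at A)"
proof -
  obtain D where D: "(matrix_inv has_derivative D) (at A)"
    using differentiable_matrix_inv[OF assms] differentiable_def by blast
  have "isCont det A"
    using has_derivative_det_permutations has_derivative_continuous by blast
  then have near: "\<forall>\<^sub>F B in nhds A. det B \<noteq> 0"
    using assms tendsto_imp_eventually_ne[of det "det A" "nhds A" 0]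
    by (simp add: isCont_def tendsto_at_iff_tendsto_nhds)
  have "((\<lambda>B. B ** matrix_inv B) has_derivative (\<lambda>V. A ** D V + V ** matrix_inv A)) (at A)"
    by (rule bounded_bilinear.FDERIV[OF bounded_bilinear_matrix_mult has_derivative_ident D])
  moreover have "\<forall>\<^sub>F B in nhds A. B ** matrix_inv B = mat 1"
    using near by (rule eventually_mono) (rule matrix_inv_inverse)
  ultimately have "((\<lambda>B. mat 1 :: real^'n^'n) has_derivative (\<lambda>V. A ** D V + V ** matrix_inv A)) (at A)"
    using has_derivative_transform_eventually[of "\<lambda>B. B ** matrix_inv B" _ A UNIV "\<lambda>B. mat 1"]
      matrix_inv_inverse(1)[OF assms] eventually_nhds_conv_at by blast
  then have "(\<lambda>V. A ** D V + V ** matrix_inv A) = (\<lambda>V. 0)"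
    by (rule has_derivative_unique[OF _ has_derivative_const])
  then have "A ** D V + V ** matrix_inv A = 0" for V
    by meson
  then have "matrix_inv A ** (A ** D V) = - (matrix_inv A ** (V ** matrix_inv A))" for V
    by (metis bounded_bilinear.minus_right[OF bounded_bilinear_matrix_mult] eq_neg_iff_add_eq_0)
  then have "D V = - (matrix_inv A ** (V ** matrix_inv A))" for V
    by (simp add: matrix_mul_assoc matrix_inv_inverse(2)[OF assms])
  then have "D = (\<lambda>V. - (matrix_inv A ** (V ** matrix_inv A)))" by blast
  with D show ?thesis by simp
qed

lemma smooth_on_matrix_inv:
  fixes G :: "'a::real_normed_vector \<Rightarrow> real^'n::finite^'n"
  assumes "open S" "smooth_on S G" "\<And>x. x \<in> S \<Longrightarrow> det (G x) \<noteq> 0"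
  shows "smooth_on S (\<lambda>x. matrix_inv (G x))"
proof (rule smooth_on_riccati[OF assms(1) _ bounded_bilinear_matrix_mult assms(2)])
  show "bounded_bilinear (\<lambda>a b::real^'n^'n. - (a ** b))"
    using bounded_bilinear.comp[OF bounded_bilinear_matrix_mult bounded_linear_minus[OF bounded_linear_ident]
        bounded_linear_ident] by (simp add: matrix_mult_expand)
  show "((\<lambda>x. matrix_inv (G x)) has_derivative (\<lambda>v. - (matrix_inv (G x) **
      (frechet_derivative G (at x) v ** matrix_inv (G x))))) (at x)" if "x \<in> S" for x
    by (rule has_derivative_compose[OF smooth_on_has_derivative[OF assms(2) that]
          has_derivative_matrix_inv[OF assms(3)[OF that]]])
qed

lemma has_derivative_ln_det:
  fixes G :: "'a::real_normed_vector \<Rightarrow> real^'n::finite^'n"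
  assumes "(G has_derivative G') (at x)" "det (G x) > 0"
  shows "((\<lambda>x. ln (det (G x))) has_derivative (\<lambda>v. trace (matrix_inv (G x) ** G' v))) (at x)"
proof -
  have nz: "det (G x) \<noteq> 0" using assms(2) by simp
  have "((\<lambda>x. det (G x)) has_derivative
      (\<lambda>v. det (G x) * trace (matrix_inv (G x) ** G' v))) (at x)"
    by (rule has_derivative_compose[OF assms(1) has_derivative_det]) (use nz matrix_inv_inverse in auto)
  from has_derivative_ln[OF assms(2) this] show ?thesis
    using nz by (simp add: divide_simps)
qed

text \<open>The logarithm needs no separate argument: by Jacobi's formula its derivative \<open>tr (G\<^sup>-\<^sup>1 G')\<close> is already known
  to be smooth.\<close>

lemma smooth_on_ln_det:
  fixes G :: "'a::real_normed_vector \<Rightarrow> real^'n::finite^'n"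
  assumes "open S" "smooth_on S G" "\<And>x. x \<in> S \<Longrightarrow> det (G x) > 0"
  shows "smooth_on S (\<lambda>x. ln (det (G x)))"
proof (rule smooth_onI[OF assms(1)])
  show "((\<lambda>x. ln (det (G x))) has_derivative
      (\<lambda>v. trace (matrix_inv (G x) ** frechet_derivative G (at x) v))) (at x)" if "x \<in> S" for x
    by (rule has_derivative_ln_det[OF smooth_on_has_derivative[OF assms(2) that] assms(3)[OF that]])
  show "smooth_on S (\<lambda>x. trace (matrix_inv (G x) ** frechet_derivative G (at x) v))" for v
    by (rule smooth_on_linear[OF bounded_linear_trace assms(1)
          smooth_on_bilinear[OF bounded_bilinear_matrix_mult assms(1)
            smooth_on_matrix_inv[OF assms(1,2)] smooth_on_frechet_derivative[OF assms(2)]]])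
       (use assms(3) in force)
qed

lemma smooth_on_ln_square:
  fixes u :: "'a::real_normed_vector \<Rightarrow> real"
  assumes "open S" "smooth_on S u" "\<And>x. x \<in> S \<Longrightarrow> u x \<noteq> 0"
  shows "smooth_on S (\<lambda>x. ln ((u x)\<^sup>2))"
proof (rule smooth_onI[OF assms(1)])
  show "((\<lambda>x. ln ((u x)\<^sup>2)) has_derivative
      (\<lambda>v. 2 *\<^sub>R (inverse (u x) * frechet_derivative u (at x) v))) (at x)" if x: "x \<in> S" for x
  proof -
    have "((\<lambda>x. (u x)\<^sup>2) has_derivative (\<lambda>v. 2 * u x * frechet_derivative u (at x) v)) (at x)"
      using smooth_on_has_derivative[OF assms(2) x] by (auto intro!: derivative_eq_intros)
    from has_derivative_ln[OF _ this] show ?thesis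
      using assms(3)[OF x] by (simp add: power2_eq_square divide_simps zero_less_mult_iff linorder_neq_iff[symmetric] mult_ac)
  qed
  show "smooth_on S (\<lambda>x. 2 *\<^sub>R (inverse (u x) * frechet_derivative u (at x) v))" for v
    by (rule smooth_on_linear[OF bounded_linear_scaleR_right assms(1)
          smooth_on_bilinear[OF bounded_bilinear_mult assms(1)
            smooth_on_inverse[OF assms(1-3)] smooth_on_frechet_derivative[OF assms(2)]]])
qed

text \<open>On the segment from the identity matrix to \<open>G\<close> all matrices are positive definite, so the determinant
  cannot change sign.\<close>

lemma inner_product_matrix_det_pos:
  fixes G :: "real^'n::finite^'n"
  assumes "inner_product_matrix G"
  shows "det G > 0"
proof (rule ccontr)
  assume "\<not> det G > 0"
  define P where "P s = (1 - s) *\<^sub>R (mat 1 :: real^'n^'n) + s *\<^sub>R G" for s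
  have nz: "det (P s) \<noteq> 0" if s: "0 \<le> s" "s \<le> 1" for s
  proof -
    have "inner_product_matrix (P s)"
      unfolding inner_product_matrix_def
    proof (intro conjI allI impI)
      show "transpose (P s) = P s"
        using assms unfolding P_def inner_product_matrix_def
        by (simp add: linear_add[OF bounded_linear.linear[OF bounded_linear_transpose]]
            linear_scale[OF bounded_linear.linear[OF bounded_linear_transpose]] transpose_mat)
      fix u :: "real^'n" assume "u \<noteq> 0"
      then have "u \<bullet> u > 0" "u \<bullet> (G *v u) > 0"
        using assms by (auto simp: inner_product_matrix_def)
      moreover have "u \<bullet> (P s *v u) = (1 - s) * (u \<bullet> u) + s * (u \<bullet> (G *v u))"
        unfolding P_def matrix_vector_mult_add_rdistrib inner_add_right
        by (simp add: scaleR_matrix_vector_assoc[symmetric])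
      ultimately show "u \<bullet> (P s *v u) > 0"
        using s by (cases "s = 0") (auto intro!: add_nonneg_pos)
    qed
    from inner_product_matrix_inverse(1)[OF this] have "det (P s) * det (matrix_inv (P s)) = 1"
      by (metis det_I det_mul)
    then show ?thesis by auto
  qed
  have "continuous_on {0..1} (\<lambda>s. det (P s))"
  proof -
    have 1: "continuous_on UNIV (det :: real^'n^'n \<Rightarrow> real)"
      using has_derivative_det_permutations
      by (meson continuous_at_imp_continuous_on has_derivative_continuous)
    have 2: "continuous_on {0..1} P" unfolding P_def by (intro continuous_intros)
    show ?thesis by (rule continuous_on_compose2[OF 1 2]) simp
  qed
  moreover have "det (P 0) = 1" "det (P 1) = det G" by (simp_all add: P_def det_I)
  ultimately have "\<exists>s\<ge>0. s \<le> 1 \<and> det (P s) = 0"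
    using IVT2'[of "\<lambda>s. det (P s)" 1 0 0] \<open>\<not> det G > 0\<close> by auto
  then show False using nz by blast
qed

text \<open>Squaring the density removes its sign, so that a smooth function of the density remains.\<close>

lemma log_volume_ratio_eq:
  assumes "\<Omega> c y \<noteq> 0" "det (g c y) > 0"
  shows "log_volume_ratio \<Omega> g c y = (1/2) *\<^sub>R (ln (det (g c y)) - ln ((\<Omega> c y)\<^sup>2))"
proof -
  have "riemannian_volume \<Omega> g c y / \<Omega> c y = sqrt (det (g c y)) / \<bar>\<Omega> c y\<bar>"
    using assms(1) by (simp add: riemannian_volume_def sgn_if)
  also have "ln \<dots> = ln (det (g c y)) / 2 - ln \<bar>\<Omega> c y\<bar>"
    using assms by (simp add: ln_div ln_sqrt)
  also have "ln \<bar>\<Omega> c y\<bar> = ln ((\<Omega> c y)\<^sup>2) / 2"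
    using ln_realpow[of "\<bar>\<Omega> c y\<bar>" 2] assms(1) by simp
  finally show ?thesis
    by (simp add: log_volume_ratio_def)
qed

section \<open>The Levi-Civita connection in a chart\<close>

lemma linear_eq_axis:
  fixes P Q :: "real^'n::finite \<Rightarrow> 'b::real_vector"
  assumes "linear P" "linear Q" "\<And>i. P (axis i 1) = Q (axis i 1)"
  shows "P u = Q u"
  using linear_eq_stdbasis[OF assms(1,2)] assms(3) by (auto simp: Basis_vec_def)

lemma frechet_derivative_symmetric:
  fixes V :: "real^'n::finite \<Rightarrow> real^'n^'n"
  assumes "open U" "y \<in> U" "\<And>z. z \<in> U \<Longrightarrow> transpose (V z) = V z" "V differentiable (at y)"
  shows "transpose (frechet_derivative V (at y) u) = frechet_derivative V (at y) u"
proof -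
  have d: "(V has_derivative frechet_derivative V (at y)) (at y)"
    using assms(4) frechet_derivative_works by blast
  have "((\<lambda>z. transpose (V z)) has_derivative (\<lambda>v. transpose (frechet_derivative V (at y) v))) (at y)"
    using bounded_linear.has_derivative[OF bounded_linear_transpose d] .
  then have "(V has_derivative (\<lambda>v. transpose (frechet_derivative V (at y) v))) (at y)"
    by (rule has_derivative_transform_within_open[OF _ assms(1,2)]) (use assms(3) in auto)
  then have "frechet_derivative V (at y) = (\<lambda>v. transpose (frechet_derivative V (at y) v))"
    using d has_derivative_unique by blast
  then show ?thesis by metis
qed

lemma linear_connection_matrix: "linear (connection_matrix g y)"
  by (rule linearI)
     (simp_all add: connection_matrix_def vec_eq_iff distrib_right sum.distrib sum_distrib_left mult.assoc)

lemma connection_matrix_axis: "connection_matrix g y (axis i 1) $ k $ j = christoffel g y i j k"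
proof -
  have "(\<Sum>l\<in>UNIV. axis i 1 $ l * christoffel g y l j k) =
      (\<Sum>l\<in>UNIV. if l = i then christoffel g y l j k else 0)"
    by (intro sum.cong) (auto simp: axis_def)
  then show ?thesis by (simp add: connection_matrix_def)
qed

lemma nabla_vec_apply:
  assumes "\<xi> differentiable (at y)"
  shows "nabla_vec g \<xi> y *v v = frechet_derivative \<xi> (at y) v + connection_matrix g y v *v \<xi> y"
proof -
  have "linear (\<lambda>v. frechet_derivative \<xi> (at y) v + connection_matrix g y v *v \<xi> y)"
    by (intro linear_compose_add linear_frechet_derivative[OF assms]
        linear_compose[OF linear_connection_matrix, unfolded o_def]
        bounded_linear.linear[OF bounded_bilinear.bounded_linear_left[OF bounded_bilinear_matrix_vector_mult]])
  then show ?thesis unfolding nabla_vec_def by (simp add: matrix_works)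
qed

lemma nabla_vec_scaleR:
  assumes "\<xi> differentiable (at y)"
  shows "nabla_vec g (\<lambda>z. r *\<^sub>R \<xi> z) y = r *\<^sub>R nabla_vec g \<xi> y"
proof -
  have "((\<lambda>z. r *\<^sub>R \<xi> z) has_derivative (\<lambda>v. r *\<^sub>R frechet_derivative \<xi> (at y) v)) (at y)"
    using assms frechet_derivative_works has_derivative_scaleR_right by blast
  then have "frechet_derivative (\<lambda>z. r *\<^sub>R \<xi> z) (at y) = (\<lambda>v. r *\<^sub>R frechet_derivative \<xi> (at y) v)"
    by (rule frechet_derivative_at[symmetric])
  then show ?thesis
    by (simp add: nabla_vec_def matrix_def vec_eq_iff matrix_vector_mult_scaleR algebra_simps)
qed

lemma nabla_vec_cong:
  assumes "open U" "y \<in> U" "\<And>z. z \<in> U \<Longrightarrow> \<xi> z = \<xi>' z" "\<xi> differentiable (at y)"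
  shows "nabla_vec g \<xi> y = nabla_vec g \<xi>' y"
  using frechet_derivative_transform_within_open[OF assms(4,1,2,3)] assms(2,3)
  by (simp add: nabla_vec_def)

lemma nabla_vec_mult:
  assumes "S differentiable (at y)" "\<xi> differentiable (at y)"
  shows "nabla_vec g (\<lambda>z. S z *v \<xi> z) y *v v =
    nabla_endo g S y v *v \<xi> y + S y *v (nabla_vec g \<xi> y *v v)"
proof -
  have d: "((\<lambda>z. S z *v \<xi> z) has_derivative (\<lambda>v. S y *v frechet_derivative \<xi> (at y) v +
      frechet_derivative S (at y) v *v \<xi> y)) (at y)"
    by (rule bounded_bilinear.FDERIV[OF bounded_bilinear_matrix_vector_mult])
       (use assms frechet_derivative_works in blast)+
  have "frechet_derivative (\<lambda>z. S z *v \<xi> z) (at y) = (\<lambda>v. S y *v frechet_derivative \<xi> (at y) v +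
      frechet_derivative S (at y) v *v \<xi> y)"
    using d by (rule frechet_derivative_at[symmetric])
  moreover have "(\<lambda>z. S z *v \<xi> z) differentiable (at y)"
    using d unfolding differentiable_def by blast
  ultimately show ?thesis
    by (simp add: nabla_vec_apply assms nabla_endo_def commutator_def matrix_vector_mult_expand
        matrix_vector_mul_assoc)
qed

text \<open>Since \<open>J\<close> is parallel, covariant differentiation commutes with taking the anti-linear part.\<close>

lemma nabla_endo_part01:
  assumes "S differentiable (at y)" "J differentiable (at y)" "nabla_endo g J y v = 0"
  shows "nabla_endo g (\<lambda>z. part01 (J z) (S z)) y v = part01 (J y) (nabla_endo g S y v)"
proof -
  let ?\<Gamma> = "connection_matrix g y v"
  let ?S = "frechet_derivative S (at y)" and ?J = "frechet_derivative J (at y)"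
  note dS = assms(1)[unfolded frechet_derivative_works] and dJ = assms(2)[unfolded frechet_derivative_works]
  note mult = bounded_bilinear.FDERIV[OF bounded_bilinear_matrix_mult]
  have "((\<lambda>z. part01 (J z) (S z)) has_derivative (\<lambda>v. (1/2) *\<^sub>R (?S v +
      (J y ** S y ** ?J v + (J y ** ?S v + ?J v ** S y) ** J y)))) (at y)"
    unfolding part01_def
    by (intro has_derivative_scaleR_right has_derivative_add mult dS dJ)
  then have 1: "frechet_derivative (\<lambda>z. part01 (J z) (S z)) (at y) = (\<lambda>v. (1/2) *\<^sub>R (?S v +
      (J y ** S y ** ?J v + (J y ** ?S v + ?J v ** S y) ** J y)))"
    by (rule frechet_derivative_at[symmetric])
  have J: "?J v = J y ** ?\<Gamma> - ?\<Gamma> ** J y"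
    using assms(3) by (simp add: nabla_endo_def commutator_def algebra_simps)
  show ?thesis
    unfolding nabla_endo_def 1 J
    by (simp add: part01_def commutator_def matrix_mult_expand matrix_mul_assoc algebra_simps)
qed

lemma nabla_vec_diff:
  assumes "\<xi> differentiable (at y)" "\<eta> differentiable (at y)"
  shows "nabla_vec g (\<lambda>z. \<xi> z - \<eta> z) y = nabla_vec g \<xi> y - nabla_vec g \<eta> y"
proof -
  have "((\<lambda>z. \<xi> z - \<eta> z) has_derivative
      (\<lambda>v. frechet_derivative \<xi> (at y) v - frechet_derivative \<eta> (at y) v)) (at y)"
    using assms frechet_derivative_works has_derivative_diff by blast
  then have D: "frechet_derivative (\<lambda>z. \<xi> z - \<eta> z) (at y) =
      (\<lambda>v. frechet_derivative \<xi> (at y) v - frechet_derivative \<eta> (at y) v)"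
    by (rule frechet_derivative_at[symmetric])
  show ?thesis
    by (simp add: nabla_vec_def D matrix_def vec_eq_iff matrix_vector_mult_diff_distrib)
qed

lemma grad_cong:
  assumes "open U" "y \<in> U" "\<And>z. z \<in> U \<Longrightarrow> \<phi> z = \<psi> z" "\<phi> differentiable (at y)"
  shows "grad g \<phi> y = grad g \<psi> y"
  using frechet_derivative_transform_within_open[OF assms(4,1,2,3)]
  by (simp add: grad_def pderiv_at_def)

lemma grad_scaleR:
  assumes "\<phi> differentiable (at y)"
  shows "grad g (\<lambda>z. r *\<^sub>R \<phi> z) y = r *\<^sub>R grad g \<phi> y"
proof -
  have "((\<lambda>z. r *\<^sub>R \<phi> z) has_derivative (\<lambda>v. r *\<^sub>R frechet_derivative \<phi> (at y) v)) (at y)"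
    using assms frechet_derivative_works has_derivative_scaleR_right by blast
  then have D: "frechet_derivative (\<lambda>z. r *\<^sub>R \<phi> z) (at y) = (\<lambda>v. r *\<^sub>R frechet_derivative \<phi> (at y) v)"
    by (rule frechet_derivative_at[symmetric])
  have "(\<chi> i. pderiv_at (\<lambda>z. r *\<^sub>R \<phi> z) y i) = r *\<^sub>R (\<chi> i. pderiv_at \<phi> y i)"
    by (simp only: vec_eq_iff pderiv_at_def D vector_scaleR_component vec_lambda_beta simp_thms)
  then show ?thesis
    unfolding grad_def by (simp only: matrix_vector_mult_scaleR)
qed

locale riemannian_chart =
  fixes U :: "(real^'n::finite) set" and g :: "real^'n \<Rightarrow> real^'n^'n"
  assumes open_domain: "open U"
    and smooth_metric: "smooth_on U g"
    and inner_metric: "y \<in> U \<Longrightarrow> inner_product_matrix (g y)"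
begin

lemma metric_differentiable: "y \<in> U \<Longrightarrow> g differentiable (at y)"
  using smooth_on_has_derivative[OF smooth_metric] by (auto simp: differentiable_def)

lemma metric_symmetric: "y \<in> U \<Longrightarrow> transpose (g y) = g y"
  using inner_metric by (simp add: inner_product_matrix_def)

text \<open>Torsion-freeness and the metric compatibility in the next lemma determine the connection; its
  variation is computed from these two properties rather than from the Christoffel symbols.\<close>

lemma connection_torsion_free:
  assumes "y \<in> U"
  shows "connection_matrix g y u *v w = connection_matrix g y w *v u"
proof -
  have s: "christoffel g y i j k = christoffel g y j i k" for i j k
    using levi_civita(1)[OF open_domain assms inner_metric metric_differentiable[OF assms]] .
  have "(connection_matrix g y u *v w) $ k = (connection_matrix g y w *v u) $ k" for k
  proof -
    have "(connection_matrix g y u *v w) $ k =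
        (\<Sum>j\<in>UNIV. \<Sum>i\<in>UNIV. u $ i * christoffel g y i j k * w $ j)"
      by (simp add: connection_matrix_def matrix_vector_mult_def sum_distrib_right)
    also have "\<dots> = (\<Sum>i\<in>UNIV. \<Sum>j\<in>UNIV. u $ i * christoffel g y i j k * w $ j)"
      by (rule sum.swap)
    also have "\<dots> = (\<Sum>i\<in>UNIV. \<Sum>j\<in>UNIV. w $ j * christoffel g y j i k * u $ i)"
      by (intro sum.cong refl) (simp only: s[of _ _ k] mult_ac)
    also have "\<dots> = (connection_matrix g y w *v u) $ k"
      by (simp add: connection_matrix_def matrix_vector_mult_def sum_distrib_right)
    finally show ?thesis .
  qed
  then show ?thesis by (simp add: vec_eq_iff)
qed

lemma connection_metric:
  assumes y: "y \<in> U"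
  shows "frechet_derivative g (at y) u =
    g y ** connection_matrix g y u + transpose (connection_matrix g y u) ** g y"
proof (rule linear_eq_axis[where u = u])
  show "linear (frechet_derivative g (at y))"
    using linear_frechet_derivative metric_differentiable[OF y] .
  show "linear (\<lambda>u. g y ** connection_matrix g y u + transpose (connection_matrix g y u) ** g y)"
    by (rule linearI)
       (simp_all add: linear_add[OF linear_connection_matrix] linear_scale[OF linear_connection_matrix]
         linear_add[OF bounded_linear.linear[OF bounded_linear_transpose]]
         linear_scale[OF bounded_linear.linear[OF bounded_linear_transpose]]
         matrix_mult_expand scaleR_add_right)
  fix i
  have "frechet_derivative g (at y) (axis i 1) $ j $ m =
    (g y ** connection_matrix g y (axis i 1) + transpose (connection_matrix g y (axis i 1)) ** g y) $ j $ m"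
    for j m
  proof -
    have sym: "g y $ m $ k = g y $ k $ m" for k
      using metric_symmetric[OF y] by (metis (no_types, lifting) transpose_def vec_lambda_beta)
    show ?thesis
      using levi_civita(2)[OF open_domain y inner_metric metric_differentiable[OF y], of i j m]
      by (simp add: pderiv_at_def matrix_matrix_mult_def connection_matrix_axis transpose_def sym mult_ac)
  qed
  then show "frechet_derivative g (at y) (axis i 1) =
    g y ** connection_matrix g y (axis i 1) + transpose (connection_matrix g y (axis i 1)) ** g y"
    by (simp add: vec_eq_iff)
qed

text \<open>The right-hand side is the covariant derivative of the bilinear form \<open>V\<close>; the identity says that raising
  an index commutes with covariant differentiation, because the metric is parallel.\<close>

lemma lower_nabla_sharp:
  assumes y: "y \<in> U" and V: "V differentiable (at y)"
  shows "g y ** nabla_endo g (\<lambda>z. sharp (g z) (V z)) y u =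
    frechet_derivative V (at y) u - transpose (connection_matrix g y u) ** V y
      - V y ** connection_matrix g y u"
proof -
  define h where "h = (\<lambda>z. sharp (g z) (V z))"
  let ?\<Gamma> = "connection_matrix g y u"
  have det: "det (g z) \<noteq> 0" if "z \<in> U" for z
    using inner_product_matrix_det_pos[OF inner_metric[OF that]] by simp
  have dg: "(g has_derivative frechet_derivative g (at y)) (at y)"
    using smooth_on_has_derivative[OF smooth_metric y] .
  have "h differentiable (at y)"
    using bounded_bilinear.FDERIV[OF bounded_bilinear_matrix_mult
        has_derivative_compose[OF dg has_derivative_matrix_inv[OF det[OF y]]]
        V[unfolded frechet_derivative_works]]
    unfolding h_def sharp_def by (rule differentiableI)
  then have dh: "(h has_derivative frechet_derivative h (at y)) (at y)"
    by (rule frechet_derivative_works[THEN iffD1])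
  have gh: "g z ** h z = V z" if "z \<in> U" for z
    by (simp add: h_def sharp_def matrix_mul_assoc matrix_inv_inverse[OF det[OF that]])
  have "((\<lambda>z. g z ** h z) has_derivative (\<lambda>v. g y ** frechet_derivative h (at y) v +
      frechet_derivative g (at y) v ** h y)) (at y)"
    by (rule bounded_bilinear.FDERIV[OF bounded_bilinear_matrix_mult dg dh])
  then have "(V has_derivative (\<lambda>v. g y ** frechet_derivative h (at y) v +
      frechet_derivative g (at y) v ** h y)) (at y)"
    by (rule has_derivative_transform_within_open[OF _ open_domain y]) (rule gh)
  then have DV: "frechet_derivative V (at y) = (\<lambda>v. g y ** frechet_derivative h (at y) v +
      frechet_derivative g (at y) v ** h y)"
    by (rule frechet_derivative_at[symmetric])
  show ?thesis
    unfolding DV connection_metric[OF y] h_def[symmetric] gh[OF y, symmetric] nabla_endo_def commutator_def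
    by (simp add: matrix_mult_expand matrix_mul_assoc)
qed

lemma lower_nabla_sharp_symmetric:
  assumes y: "y \<in> U" and V: "V differentiable (at y)" "\<And>z. z \<in> U \<Longrightarrow> transpose (V z) = V z"
  shows "transpose (g y ** nabla_endo g (\<lambda>z. sharp (g z) (V z)) y u) =
    g y ** nabla_endo g (\<lambda>z. sharp (g z) (V z)) y u"
  using frechet_derivative_symmetric[OF open_domain y V(2,1)] V(2)[OF y]
  unfolding lower_nabla_sharp[OF y V(1)]
  by (simp add: linear_diff[OF bounded_linear.linear[OF bounded_linear_transpose]]
      matrix_transpose_mul transpose_transpose)

end

lemma nabla_endo_trace:
  "trace (nabla_endo g S y u) = trace (frechet_derivative S (at y) u)"
  by (simp add: nabla_endo_def commutator_def trace_add trace_sub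
      trace_mul_sym[of "connection_matrix g y u" "S y"])

text \<open>A trilinear form that is symmetric in its first two and skew in its last two arguments vanishes: going
  around the six permutations of the arguments changes its sign. This is the argument behind the uniqueness of
  the Levi-Civita connection.\<close>

lemma symmetric_antisymmetric_zero:
  fixes G :: "real^'n::finite^'n" and K :: "real^'n \<Rightarrow> real^'n^'n"
  assumes G: "inner_product_matrix G"
    and sym: "\<And>u w. K u *v w = K w *v u"
    and anti: "\<And>u. transpose (G ** K u) = - (G ** K u)"
  shows "K u = 0"
proof -
  define a where "a u v w = w \<bullet> (G ** K u *v v)" for u v w
  have 1: "a u v w = a v u w" for u v w
    by (simp add: a_def matrix_vector_mul_assoc[symmetric] sym[of u v])
  have 2: "a u v w = - a u w v" for u v w
  proof -
    have "a u v w = (transpose (G ** K u) *v w) \<bullet> v"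
      unfolding a_def by (rule inner_matrix_transpose)
    also have "\<dots> = - a u w v"
      unfolding anti a_def by (simp add: matrix_vector_mult_expand inner_commute)
    finally show ?thesis .
  qed
  have "a u v w = 0" for u v w
    using 1[of u v w] 2[of v u w] 1[of v w u] 2[of w v u] 1[of w u v] 2[of u w v] by linarith
  then have "G ** K u *v v = 0" for v
    unfolding a_def by (metis inner_eq_zero_iff)
  then have "G ** K u = 0"
    by (simp add: matrix_eq)
  then have "matrix_inv G ** (G ** K u) = 0"
    by (metis (no_types, lifting) bounded_bilinear.zero_right[OF bounded_bilinear_matrix_mult])
  then show ?thesis
    by (simp add: matrix_mul_assoc inner_product_matrix_inverse[OF G])
qed

section \<open>Metric traces of totally symmetric tensors\<close>

lemma metric_trace_add: "metric_trace G (\<lambda>u v. P u v + Q u v) = metric_trace G P + metric_trace G Q"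
  by (simp add: metric_trace_def scaleR_add_right sum.distrib)

lemma metric_trace_diff: "metric_trace G (\<lambda>u v. P u v - Q u v) = metric_trace G P - metric_trace G Q"
  by (simp add: metric_trace_def scaleR_diff_right sum_subtractf)

lemma metric_trace_linear:
  assumes "linear L"
  shows "metric_trace G (\<lambda>u v. L (P u v)) = L (metric_trace G P)"
  by (simp add: metric_trace_def linear_sum[OF assms] linear_scale[OF assms])

lemma matrix_entry: "axis i 1 \<bullet> (M *v axis j 1) = (M :: real^'n::finite^'n) $ i $ j"
  by (simp add: inner_axis' matrix_vector_mult_basis column_def)

text \<open>Pairing the trace with a vector \<open>w\<close> and moving \<open>w\<close> into the first slot of \<open>B\<close> turns a sum of vectors
  \<open>B (M e\<^sub>i) (N e\<^sub>j)\<close> into the trace of an endomorphism built from \<open>B w\<close> alone. The matrices \<open>M\<close> and \<open>N\<close> are kept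
  because the complex structure may act on either argument.\<close>

lemma metric_trace_totally_symmetric:
  fixes G :: "real^'n::finite^'n" and B :: "real^'n \<Rightarrow> real^'n^'n"
  assumes G: "inner_product_matrix G"
    and sym: "\<And>u w. B u *v w = B w *v u"
    and self_adjoint: "\<And>u. transpose (G ** B u) = G ** B u"
  shows "G *v metric_trace G (\<lambda>u v. B (M *v u) *v (N *v v)) =
    (\<chi> m. trace (matrix_inv G ** (transpose N ** (G ** B (axis m 1)) ** M)))"
proof -
  have "(G *v metric_trace G (\<lambda>u v. B (M *v u) *v (N *v v))) $ m =
      trace (matrix_inv G ** (transpose N ** (G ** B (axis m 1)) ** M))" for m
  proof -
    let ?w = "axis m 1 :: real^'n"
    have entry: "?w \<bullet> (G *v (B (M *v axis i 1) *v (N *v axis j 1))) =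
        (transpose N ** (G ** B ?w) ** M) $ j $ i" for i j
    proof -
      have "?w \<bullet> (G *v (B (M *v axis i 1) *v (N *v axis j 1))) =
          ?w \<bullet> ((G ** B (M *v axis i 1)) *v (N *v axis j 1))"
        by (simp only: matrix_vector_mul_assoc matrix_mul_assoc)
      also have "\<dots> = (transpose (G ** B (M *v axis i 1)) *v ?w) \<bullet> (N *v axis j 1)"
        by (rule inner_matrix_transpose)
      also have "\<dots> = (G *v (B (M *v axis i 1) *v ?w)) \<bullet> (N *v axis j 1)"
        by (simp only: self_adjoint matrix_vector_mul_assoc)
      also have "\<dots> = (G *v (B ?w *v (M *v axis i 1))) \<bullet> (N *v axis j 1)"
        by (simp only: sym[of "M *v axis i 1" ?w])
      also have "\<dots> = (transpose N *v (G *v (B ?w *v (M *v axis i 1)))) \<bullet> axis j 1"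
        by (rule inner_matrix_transpose)
      also have "\<dots> = axis j 1 \<bullet> ((transpose N ** (G ** B ?w) ** M) *v axis i 1)"
        by (simp only: matrix_vector_mul_assoc matrix_mul_assoc inner_commute)
      finally show ?thesis by (simp only: matrix_entry)
    qed
    have "linear (\<lambda>x. ?w \<bullet> (G *v x))"
      by (rule linearI) (simp_all add: matrix_vector_mult_expand inner_add_right)
    then have lin: "?w \<bullet> (G *v metric_trace G P) = metric_trace G (\<lambda>u v. ?w \<bullet> (G *v P u v))"
      for P :: "real^'n \<Rightarrow> real^'n \<Rightarrow> real^'n"
      using metric_trace_linear[of "\<lambda>x. ?w \<bullet> (G *v x)" G P] by simp
    have "(G *v metric_trace G (\<lambda>u v. B (M *v u) *v (N *v v))) $ m =
        ?w \<bullet> (G *v metric_trace G (\<lambda>u v. B (M *v u) *v (N *v v)))"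
      by (simp only: inner_axis' inner_real_def mult_1_left)
    also have "\<dots> = (\<Sum>i\<in>UNIV. \<Sum>j\<in>UNIV. matrix_inv G $ i $ j * (transpose N ** (G ** B ?w) ** M) $ j $ i)"
      unfolding lin by (simp only: metric_trace_def entry real_scaleR_def)
    also have "\<dots> = trace (matrix_inv G ** (transpose N ** (G ** B ?w) ** M))"
      by (simp only: trace_def matrix_matrix_mult_def[of "matrix_inv G"] vec_lambda_beta)
    finally show ?thesis .
  qed
  then show ?thesis by (simp add: vec_eq_iff)
qed

lemma inner_product_matrix_cancel:
  fixes x z :: "real^'n::finite"
  assumes "inner_product_matrix G" "G *v x = G *v z"
  shows "x = z"
proof -
  have "matrix_inv G *v (G *v x) = matrix_inv G *v (G *v z)" using assms(2) by simp
  then show ?thesis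
    by (simp only: matrix_vector_mul_assoc inner_product_matrix_inverse[OF assms(1)] matrix_vector_mul_lid)
qed

text \<open>The divergence of a self-adjoint endomorphism satisfying the Codazzi equation is the gradient of its trace.\<close>

lemma metric_trace_divergence:
  fixes G :: "real^'n::finite^'n" and B :: "real^'n \<Rightarrow> real^'n^'n"
  assumes G: "inner_product_matrix G"
    and sym: "\<And>u w. B u *v w = B w *v u"
    and self_adjoint: "\<And>u. transpose (G ** B u) = G ** B u"
  shows "metric_trace G (\<lambda>u v. B u *v v) = matrix_inv G *v (\<chi> m. trace (B (axis m 1)))"
proof (rule inner_product_matrix_cancel[OF G])
  have "G *v metric_trace G (\<lambda>u v. B u *v v) = (\<chi> m. trace (B (axis m 1)))"
    using metric_trace_totally_symmetric[OF G sym self_adjoint, of "mat 1" "mat 1"]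
    by (simp only: matrix_vector_mul_lid transpose_mat matrix_mul_lid matrix_mul_rid
        matrix_mul_assoc inner_product_matrix_inverse(2)[OF G])
  also have "\<dots> = G *v (matrix_inv G *v (\<chi> m. trace (B (axis m 1))))"
    by (simp only: matrix_vector_mul_assoc inner_product_matrix_inverse[OF G] matrix_vector_mul_lid)
  finally show "G *v metric_trace G (\<lambda>u v. B u *v v) =
    G *v (matrix_inv G *v (\<chi> m. trace (B (axis m 1))))" .
qed

text \<open>The first equality is invariance of the trace under the isometry \<open>J\<close>, the second its symmetry combined with
  that of \<open>B\<close>.\<close>

lemma metric_trace_rotate:
  fixes G J :: "real^'n::finite^'n" and B :: "real^'n \<Rightarrow> real^'n^'n"
  assumes G: "inner_product_matrix G"
    and sym: "\<And>u w. B u *v w = B w *v u"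
    and self_adjoint: "\<And>u. transpose (G ** B u) = G ** B u"
    and J: "transpose J ** G ** J = G"
  shows "metric_trace G (\<lambda>u v. B (J *v u) *v (J *v v)) = metric_trace G (\<lambda>u v. B u *v v)"
    and "metric_trace G (\<lambda>u v. B u *v (J *v v)) = metric_trace G (\<lambda>u v. B (J *v u) *v v)"
proof -
  note tr = metric_trace_totally_symmetric[OF G sym self_adjoint]
  have 1: "trace (matrix_inv G ** (transpose J ** (G ** C) ** J)) = trace (matrix_inv G ** (G ** C))"
    for C
  proof -
    have "matrix_inv G ** (transpose J ** G) ** J = mat 1"
      by (metis J inner_product_matrix_inverse(2)[OF G] matrix_mul_assoc)
    then have JI: "J ** (matrix_inv G ** (transpose J ** G)) = mat 1"
      using matrix_left_right_inverse by blast
    have "trace (matrix_inv G ** (transpose J ** (G ** C) ** J)) =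
        trace (J ** (matrix_inv G ** (transpose J ** (G ** C))))"
      using trace_mul_sym[of J] by (metis matrix_mul_assoc)
    also have "J ** (matrix_inv G ** (transpose J ** (G ** C))) = C"
      by (metis JI matrix_mul_assoc matrix_mul_lid)
    finally show ?thesis
      by (simp only: matrix_mul_assoc inner_product_matrix_inverse(2)[OF G] matrix_mul_lid)
  qed
  show "metric_trace G (\<lambda>u v. B (J *v u) *v (J *v v)) = metric_trace G (\<lambda>u v. B u *v v)"
    by (rule inner_product_matrix_cancel[OF G])
       (use tr[of J J] tr[of "mat 1" "mat 1"] 1 in \<open>simp add: transpose_mat\<close>)
  have 2: "trace (matrix_inv G ** (transpose J ** C)) = trace (matrix_inv G ** (C ** J))"
    if C: "transpose C = C" for C
  proof -
    have I: "transpose (matrix_inv G) = matrix_inv G"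
    proof -
      have "transpose (matrix_inv G) ** G = mat 1"
        using G inner_product_matrix_inverse(1)[OF G] unfolding inner_product_matrix_def
        by (metis matrix_transpose_mul transpose_mat)
      then have "transpose (matrix_inv G) ** (G ** matrix_inv G) = matrix_inv G"
        by (simp only: matrix_mul_assoc matrix_mul_lid)
      then show ?thesis
        by (simp only: inner_product_matrix_inverse(1)[OF G] matrix_mul_rid)
    qed
    have tt: "trace (transpose M) = trace M" for M :: "real^'n^'n"
      by (simp add: trace_def transpose_def)
    have "trace (matrix_inv G ** (transpose J ** C)) = trace (transpose (matrix_inv G ** (transpose J ** C)))"
      by (simp only: tt)
    also have "\<dots> = trace (C ** J ** matrix_inv G)"
      by (simp only: matrix_transpose_mul I C transpose_transpose)
    also have "\<dots> = trace (matrix_inv G ** (C ** J))"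
      by (rule trace_mul_sym)
    finally show ?thesis .
  qed
  show "metric_trace G (\<lambda>u v. B u *v (J *v v)) = metric_trace G (\<lambda>u v. B (J *v u) *v v)"
    by (rule inner_product_matrix_cancel[OF G])
       (use tr[of "mat 1" J] tr[of J "mat 1"] 2[OF self_adjoint] in \<open>simp add: transpose_mat\<close>)
qed

text \<open>The left-hand side is the trace of the (1,0)-part of the covariant derivative of \<open>h\<^sup>0\<^sup>,\<^sup>1\<close> when \<open>B\<close> is the
  covariant derivative of \<open>h\<close>.\<close>

lemma metric_trace_part01:
  fixes G J :: "real^'n::finite^'n" and B :: "real^'n \<Rightarrow> real^'n^'n"
  assumes G: "inner_product_matrix G"
    and sym: "\<And>u w. B u *v w = B w *v u"
    and self_adjoint: "\<And>u. transpose (G ** B u) = G ** B u"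
    and J: "transpose J ** G ** J = G" "J ** J = - mat 1"
  shows "metric_trace G (\<lambda>u v. (1/2) *\<^sub>R (part01 J (B u) *v v - J *v (part01 J (B (J *v u)) *v v))) =
    (1/2) *\<^sub>R metric_trace G (\<lambda>u v. B u *v v)"
proof -
  have JJ: "J *v (J *v x) = - x" for x
    by (simp add: matrix_vector_mul_assoc J(2) matrix_vector_mult_expand)
  have "(1/2) *\<^sub>R (part01 J (B u) *v v - J *v (part01 J (B (J *v u)) *v v)) =
     (1/4) *\<^sub>R ((B u *v v + B (J *v u) *v (J *v v)) + J *v (B u *v (J *v v) - B (J *v u) *v v))" for u v
    by (simp add: part01_def matrix_vector_mult_expand matrix_vector_mul_assoc[symmetric] JJ
        scaleR_add_right scaleR_diff_right)
  then have "metric_trace G (\<lambda>u v. (1/2) *\<^sub>R (part01 J (B u) *v v - J *v (part01 J (B (J *v u)) *v v))) =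
     metric_trace G (\<lambda>u v. (1/4) *\<^sub>R
       ((B u *v v + B (J *v u) *v (J *v v)) + J *v (B u *v (J *v v) - B (J *v u) *v v)))"
    by simp
  also have "\<dots> = (1/4) *\<^sub>R ((metric_trace G (\<lambda>u v. B u *v v) + metric_trace G (\<lambda>u v. B (J *v u) *v (J *v v)))
      + J *v (metric_trace G (\<lambda>u v. B u *v (J *v v)) - metric_trace G (\<lambda>u v. B (J *v u) *v v)))"
    by (simp only: metric_trace_linear[OF bounded_linear.linear[OF bounded_linear_scaleR_right]]
        metric_trace_linear[OF matrix_vector_mul_linear] metric_trace_add metric_trace_diff)
  also have "\<dots> = (1/2) *\<^sub>R metric_trace G (\<lambda>u v. B u *v v)"
    unfolding metric_trace_rotate[OF G sym self_adjoint J(1)]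
    by (simp add: scaleR_add_right[symmetric] scaleR_2[symmetric])
  finally show ?thesis .
qed

section \<open>Paths of metrics with Codazzi velocity\<close>

text \<open>The last assumption places the velocity of the metric in \<open>F\<close>: raised to an endomorphism, it satisfies the
  Codazzi equation.\<close>

locale codazzi_path =
  fixes T :: "real set" and U :: "(real^'n::finite) set" and G :: "real \<Rightarrow> real^'n \<Rightarrow> real^'n^'n"
  assumes open_time: "open T" and open_space: "open U"
    and smooth_G: "smooth_family T U G"
    and inner_G: "t \<in> T \<Longrightarrow> y \<in> U \<Longrightarrow> inner_product_matrix (G t y)"
    and codazzi: "t \<in> T \<Longrightarrow> y \<in> U \<Longrightarrow>
      nabla_endo (G t) (\<lambda>z. sharp (G t z) (dt G t z)) y u *v w =
      nabla_endo (G t) (\<lambda>z. sharp (G t z) (dt G t z)) y w *v u"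
begin

definition H :: "real \<Rightarrow> real^'n \<Rightarrow> real^'n^'n" where
  "H t y = sharp (G t y) (dt G t y)"

abbreviation B :: "real \<Rightarrow> real^'n \<Rightarrow> real^'n \<Rightarrow> real^'n^'n" where
  "B t y \<equiv> nabla_endo (G t) (H t) y"

lemma H_eq: "H t = (\<lambda>z. sharp (G t z) (dt G t z))"
  by (simp add: H_def fun_eq_iff)

lemma B_symmetric: "t \<in> T \<Longrightarrow> y \<in> U \<Longrightarrow> B t y u *v w = B t y w *v u"
  unfolding H_eq by (rule codazzi)

lemma riemannian_slice: "t \<in> T \<Longrightarrow> riemannian_chart U (G t)"
  by unfold_locales (use open_space smooth_family_slice[OF open_space smooth_G] inner_G in auto)

lemmas smooth_intros =
  smooth_family_add[OF open_time open_space]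
  smooth_family_sum[OF open_time open_space]
  smooth_family_bilinear[OF bounded_bilinear_mult open_time open_space]
  smooth_family_linear[OF bounded_linear_minus[OF bounded_linear_ident] open_time open_space]
  smooth_family_linear[OF bounded_linear_vec_nth open_time open_space]
  smooth_family_const
  smooth_family_frechet_derivative[OF open_time open_space]

lemma smooth_inverse_G: "smooth_family T U (\<lambda>t y. matrix_inv (G t y))"
  unfolding smooth_family_def
  by (rule smooth_on_matrix_inv[OF open_Times[OF open_time open_space] smooth_G[unfolded smooth_family_def]])
     (use inner_product_matrix_det_pos inner_G in force)

lemma smooth_H: "smooth_family T U H"
  unfolding H_def[abs_def] sharp_def
  by (rule smooth_family_bilinear[OF bounded_bilinear_matrix_mult open_time open_space smooth_inverse_G
      smooth_family_dt[OF open_time open_space smooth_G]])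

lemma smooth_connection: "smooth_family T U (\<lambda>t y. connection_matrix (G t) y u)"
proof -
  have "smooth_family T U (\<lambda>t y. christoffel (G t) y i j k)" for i j k
    unfolding christoffel_def pderiv_at_def diff_conv_add_uminus
    by (intro smooth_intros smooth_inverse_G smooth_G)
  then have "smooth_family T U (\<lambda>t y. connection_matrix (G t) y u $ k $ j)" for k j
    unfolding connection_matrix_def vec_lambda_beta by (intro smooth_intros)
  then show ?thesis
    by (intro smooth_family_vec open_time open_space)
qed

lemma smooth_grad:
  assumes "smooth_family T U F"
  shows "smooth_family T U (\<lambda>t. grad (G t) (F t))"
proof -
  have "smooth_family T U (\<lambda>t y. \<chi> i. pderiv_at (F t) y i)"
    by (rule smooth_family_vec[OF open_time open_space], unfold pderiv_at_def vec_lambda_beta)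
       (intro smooth_intros assms)
  from smooth_family_bilinear[OF bounded_bilinear_matrix_vector_mult open_time open_space smooth_inverse_G this]
  show ?thesis unfolding grad_def .
qed

lemma dt_G_symmetric:
  assumes "t \<in> T" "y \<in> U"
  shows "transpose (dt G t y) = dt G t y"
proof (rule has_vector_derivative_eq[OF _ _ open_time assms(1)])
  show d: "((\<lambda>s. G s y) has_vector_derivative dt G t y) (at t)"
    by (rule smooth_family_time(1)[OF smooth_G assms])
  show "((\<lambda>s. transpose (G s y)) has_vector_derivative transpose (dt G t y)) (at t)"
    by (rule bounded_linear.has_vector_derivative[OF bounded_linear_transpose d])
qed (use inner_G assms in \<open>simp add: inner_product_matrix_def\<close>)

lemma family_differentiable:
  "smooth_family T U \<Phi> \<Longrightarrow> t \<in> T \<Longrightarrow> y \<in> U \<Longrightarrow> \<Phi> t differentiable (at y)"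
  unfolding differentiable_def using smooth_family_space(1) by blast

lemma B_self_adjoint:
  assumes "t \<in> T" "y \<in> U"
  shows "transpose (G t y ** B t y u) = G t y ** B t y u"
proof -
  interpret riemannian_chart U "G t" by (rule riemannian_slice[OF assms(1)])
  show ?thesis
    unfolding H_eq
    by (rule lower_nabla_sharp_symmetric[OF assms(2)
          family_differentiable[OF smooth_family_dt[OF open_time open_space smooth_G] assms]
          dt_G_symmetric[OF assms(1)]])
qed

text \<open>The usual formula expresses the variation of the connection by three covariant derivatives of \<open>g'\<close>;
  total symmetry makes them equal, which leaves \<open>B / 2\<close>.\<close>

lemma connection_variation:
  assumes t: "t \<in> T" and y: "y \<in> U"
  shows "((\<lambda>s. connection_matrix (G s) y u) has_vector_derivative (1/2) *\<^sub>R B t y u) (at t)"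
proof -
  define C where "C u = dt (\<lambda>s y. connection_matrix (G s) y u) t y" for u
  let ?\<Gamma> = "\<lambda>s. connection_matrix (G s) y"
  interpret riemannian_chart U "G t" by (rule riemannian_slice[OF t])
  have dC: "((\<lambda>s. ?\<Gamma> s u) has_vector_derivative C u) (at t)" for u
    unfolding C_def by (rule smooth_family_time(1)[OF smooth_connection t y])
  have dG: "((\<lambda>s. G s y) has_vector_derivative dt G t y) (at t)"
    by (rule smooth_family_time(1)[OF smooth_G t y])
  have dC_apply: "((\<lambda>s. ?\<Gamma> s u *v w) has_vector_derivative C u *v w) (at t)" for u w
    by (rule bounded_linear.has_vector_derivative[OF
          bounded_bilinear.bounded_linear_left[OF bounded_bilinear_matrix_vector_mult] dC])
  have torsion_free: "C u *v w = C w *v u" for u w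
  proof (rule has_vector_derivative_eq[OF dC_apply dC_apply open_time t])
    show "?\<Gamma> s u *v w = ?\<Gamma> s w *v u" if "s \<in> T" for s
      by (rule riemannian_chart.connection_torsion_free[OF riemannian_slice[OF that] y])
  qed
  have compatible: "frechet_derivative (dt G t) (at y) u =
      (G t y ** C u + dt G t y ** ?\<Gamma> t u) + (transpose (?\<Gamma> t u) ** dt G t y + transpose (C u) ** G t y)" for u
  proof (rule has_vector_derivative_eq[OF _ _ open_time t])
    show "((\<lambda>s. frechet_derivative (G s) (at y) u) has_vector_derivative
        frechet_derivative (dt G t) (at y) u) (at t)"
      by (rule dt_frechet_derivative[OF open_time open_space smooth_G t y])
    show "((\<lambda>s. G s y ** ?\<Gamma> s u + transpose (?\<Gamma> s u) ** G s y) has_vector_derivative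
      (G t y ** C u + dt G t y ** ?\<Gamma> t u) + (transpose (?\<Gamma> t u) ** dt G t y + transpose (C u) ** G t y)) (at t)"
      by (intro has_vector_derivative_add
          bounded_bilinear.has_vector_derivative[OF bounded_bilinear_matrix_mult]
          bounded_linear.has_vector_derivative[OF bounded_linear_transpose] dC dG)
    show "frechet_derivative (G s) (at y) u = G s y ** ?\<Gamma> s u + transpose (?\<Gamma> s u) ** G s y"
      if "s \<in> T" for s
      by (rule riemannian_chart.connection_metric[OF riemannian_slice[OF that] y])
  qed
  have GB: "G t y ** B t y u = G t y ** C u + transpose (C u) ** G t y" for u
    unfolding H_eq lower_nabla_sharp[OF y family_differentiable[OF smooth_family_dt[OF open_time open_space smooth_G] t y]]
      compatible
    by simp
  have "C u - (1/2) *\<^sub>R B t y u = 0"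
  proof (rule symmetric_antisymmetric_zero[OF inner_G[OF t y], of "\<lambda>u. C u - (1/2) *\<^sub>R B t y u"])
    show "(C u - (1/2) *\<^sub>R B t y u) *v w = (C w - (1/2) *\<^sub>R B t y w) *v u" for u w
      by (simp add: matrix_vector_mult_diff_rdistrib scaleR_matrix_vector_assoc[symmetric]
          torsion_free[of u w] B_symmetric[OF t y, of u w])
    fix u
    have "G t y ** (C u - (1/2) *\<^sub>R B t y u) = (1/2) *\<^sub>R (G t y ** C u - transpose (C u) ** G t y)"
      by (simp add: matrix_mult_expand GB) (simp add: vec_eq_iff field_simps)
    moreover have "transpose (G t y ** C u - transpose (C u) ** G t y) =
        - (G t y ** C u - transpose (C u) ** G t y)"
      by (simp add: linear_diff[OF bounded_linear.linear[OF bounded_linear_transpose]]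
          matrix_transpose_mul transpose_transpose metric_symmetric[OF y])
    ultimately show "transpose (G t y ** (C u - (1/2) *\<^sub>R B t y u)) = - (G t y ** (C u - (1/2) *\<^sub>R B t y u))"
      by (simp only: linear_scale[OF bounded_linear.linear[OF bounded_linear_transpose]] scaleR_minus_right)
  qed
  then show ?thesis using dC[of u] by simp
qed

text \<open>The gradient varies through the function and through the inverse metric, whose derivative is \<open>- h g\<^sup>-\<^sup>1\<close>.\<close>

lemma grad_variation:
  assumes F: "smooth_family T U F" and t: "t \<in> T" and y: "y \<in> U"
  shows "((\<lambda>s. grad (G s) (F s) y) has_vector_derivative
    grad (G t) (dt F t) y - H t y *v grad (G t) (F t) y) (at t)"
proof -
  let ?I = "matrix_inv (G t y)"
  have det: "det (G t y) \<noteq> 0" using inner_product_matrix_det_pos[OF inner_G[OF t y]] by simp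
  have "((\<lambda>s. G s y) has_derivative (\<lambda>r. r *\<^sub>R dt G t y)) (at t)"
    using smooth_family_time(1)[OF smooth_G t y] by (simp add: has_vector_derivative_def)
  from has_derivative_compose[OF this has_derivative_matrix_inv[OF det]]
  have I: "((\<lambda>s. matrix_inv (G s y)) has_vector_derivative - (?I ** (dt G t y ** ?I))) (at t)"
    by (simp add: has_vector_derivative_def matrix_mult_expand)
  have p: "((\<lambda>s. \<chi> i. pderiv_at (F s) y i) has_vector_derivative (\<chi> i. pderiv_at (dt F t) y i)) (at t)"
    by (rule has_vector_derivative_vec, unfold pderiv_at_def vec_lambda_beta)
       (rule dt_frechet_derivative[OF open_time open_space F t y])
  from bounded_bilinear.has_vector_derivative[OF bounded_bilinear_matrix_vector_mult I p]
  show ?thesis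
    unfolding grad_def H_def sharp_def
    by (simp add: matrix_vector_mult_expand matrix_vector_mul_assoc matrix_mul_assoc)
qed

lemma grad_trace:
  assumes t: "t \<in> T" and y: "y \<in> U"
  shows "grad (G t) (\<lambda>z. trace (H t z)) y = metric_trace (G t y) (\<lambda>u v. B t y u *v v)"
proof -
  have "((\<lambda>z. trace (H t z)) has_derivative (\<lambda>v. trace (frechet_derivative (H t) (at y) v))) (at y)"
    by (rule bounded_linear.has_derivative[OF bounded_linear_trace smooth_family_space(1)[OF smooth_H t y]])
  then have D: "frechet_derivative (\<lambda>z. trace (H t z)) (at y) = (\<lambda>v. trace (frechet_derivative (H t) (at y) v))"
    by (rule frechet_derivative_at[symmetric])
  show ?thesis
    unfolding metric_trace_divergence[OF inner_G[OF t y] B_symmetric[OF t y] B_self_adjoint[OF t y]]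
    by (simp add: grad_def pderiv_at_def D nabla_endo_trace)
qed

lemma smooth_trace_H: "smooth_family T U (\<lambda>t y. trace (H t y))"
  by (rule smooth_family_linear[OF bounded_linear_trace open_time open_space smooth_H])

text \<open>The connection contributes \<open>B v X / 2\<close> with \<open>X = \<nabla>f\<close>, and differentiating \<open>X' = D / 2 - h X\<close> contributes
  \<open>\<nabla>\<^sub>v D / 2 - B v X - h \<nabla>\<^sub>v X\<close>. The symmetry \<open>B v X = B X v\<close> combines the two terms in \<open>B\<close> into a
  covariant derivative of \<open>h\<close> in the direction \<open>X\<close>.\<close>

lemma hessian_variation:
  assumes F: "smooth_family T U F" and t: "t \<in> T" and y: "y \<in> U"
    and dF: "\<And>z. z \<in> U \<Longrightarrow> dt F t z = (1/2) *\<^sub>R trace (H t z)"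
  shows "((\<lambda>s. nabla_vec (G s) (grad (G s) (F s)) y) has_vector_derivative
    (1/2) *\<^sub>R nabla_vec (G t) (grad (G t) (\<lambda>z. trace (H t z))) y
    - (1/2) *\<^sub>R B t y (grad (G t) (F t) y) - H t y ** nabla_vec (G t) (grad (G t) (F t)) y) (at t)"
proof (rule has_vector_derivative_columns)
  fix v
  define X where "X = (\<lambda>s. grad (G s) (F s))"
  define D where "D = grad (G t) (\<lambda>z. trace (H t z))"
  have smooth_X: "smooth_family T U X" unfolding X_def by (rule smooth_grad[OF F])
  note diff = family_differentiable[OF _ t]
  have diff_D: "D differentiable (at z)" if "z \<in> U" for z
    unfolding D_def using diff[OF smooth_grad[OF smooth_trace_H] that] .
  have X': "dt X t z = (1/2) *\<^sub>R D z - H t z *v X t z" if z: "z \<in> U" for z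
  proof -
    have "dt X t z = grad (G t) (dt F t) z - H t z *v X t z"
      unfolding X_def dt_def[of "\<lambda>s. grad (G s) (F s)"]
      by (rule vector_derivative_at[OF grad_variation[OF F t z]])
    also have "grad (G t) (dt F t) z = grad (G t) (\<lambda>z. (1/2) *\<^sub>R trace (H t z)) z"
      by (rule grad_cong[OF open_space z dF diff[OF smooth_family_dt[OF open_time open_space F] z]])
    also have "\<dots> = (1/2) *\<^sub>R D z"
      unfolding D_def by (rule grad_scaleR[OF diff[OF smooth_trace_H z]])
    finally show ?thesis .
  qed
  have HX: "(\<lambda>z. H t z *v X t z) differentiable (at y)"
    using smooth_family_space(1)[OF smooth_family_bilinear[OF bounded_bilinear_matrix_vector_mult
          open_time open_space smooth_H smooth_X] t y] by (auto simp: differentiable_def)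
  have D2: "(\<lambda>z. (1/2) *\<^sub>R D z) differentiable (at y)"
    using diff_D[OF y] by (rule differentiable_scaleR[OF differentiable_const])
  have dX: "dt X t differentiable (at y)"
    by (rule diff[OF smooth_family_dt[OF open_time open_space smooth_X] y])
  have "nabla_vec (G t) (dt X t) y = nabla_vec (G t) (\<lambda>z. (1/2) *\<^sub>R D z - H t z *v X t z) y"
    by (rule nabla_vec_cong[OF open_space y X' dX])
  also have "\<dots> = (1/2) *\<^sub>R nabla_vec (G t) D y - nabla_vec (G t) (\<lambda>z. H t z *v X t z) y"
    by (simp only: nabla_vec_diff[OF D2 HX] nabla_vec_scaleR[OF diff_D[OF y]])
  finally have "nabla_vec (G t) (dt X t) y *v v = (1/2) *\<^sub>R (nabla_vec (G t) D y *v v) -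
      (B t y v *v X t y + H t y *v (nabla_vec (G t) (X t) y *v v))"
    by (simp only: nabla_vec_mult[OF diff[OF smooth_H y] diff[OF smooth_X y]]
        matrix_vector_mult_diff_rdistrib scaleR_matrix_vector_assoc)
  then have N': "nabla_vec (G t) (dt X t) y *v v + (1/2) *\<^sub>R (B t y v *v X t y) =
      ((1/2) *\<^sub>R nabla_vec (G t) D y - (1/2) *\<^sub>R B t y (X t y) - H t y ** nabla_vec (G t) (X t) y) *v v"
    unfolding B_symmetric[OF t y, of v "X t y"]
    by (simp add: matrix_vector_mult_diff_rdistrib scaleR_matrix_vector_assoc[symmetric]
        matrix_vector_mul_assoc[symmetric])
  have "((\<lambda>s. frechet_derivative (X s) (at y) v + connection_matrix (G s) y v *v X s y) has_vector_derivative
      frechet_derivative (dt X t) (at y) v +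
      (connection_matrix (G t) y v *v dt X t y + ((1/2) *\<^sub>R B t y v) *v X t y)) (at t)"
    by (intro has_vector_derivative_add dt_frechet_derivative[OF open_time open_space smooth_X t y]
        bounded_bilinear.has_vector_derivative[OF bounded_bilinear_matrix_vector_mult]
        connection_variation[OF t y] smooth_family_time(1)[OF smooth_X t y])
  moreover have "frechet_derivative (dt X t) (at y) v +
      (connection_matrix (G t) y v *v dt X t y + ((1/2) *\<^sub>R B t y v) *v X t y) =
      ((1/2) *\<^sub>R nabla_vec (G t) D y - (1/2) *\<^sub>R B t y (X t y) - H t y ** nabla_vec (G t) (X t) y) *v v"
    by (simp only: N'[symmetric] nabla_vec_apply[OF dX] scaleR_matrix_vector_assoc add.assoc)
  ultimately have "((\<lambda>s. frechet_derivative (X s) (at y) v + connection_matrix (G s) y v *v X s y)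
      has_vector_derivative
      ((1/2) *\<^sub>R nabla_vec (G t) D y - (1/2) *\<^sub>R B t y (X t y) - H t y ** nabla_vec (G t) (X t) y) *v v) (at t)"
    by simp
  then have "((\<lambda>s. nabla_vec (G s) (X s) y *v v) has_vector_derivative
      ((1/2) *\<^sub>R nabla_vec (G t) D y - (1/2) *\<^sub>R B t y (X t y) - H t y ** nabla_vec (G t) (X t) y) *v v) (at t)"
    by (rule has_vector_derivative_transform_within_open[OF _ open_time t])
       (simp add: nabla_vec_apply[OF family_differentiable[OF smooth_X _ y]])
  then show "((\<lambda>s. nabla_vec (G s) (grad (G s) (F s)) y *v v) has_vector_derivative
    ((1/2) *\<^sub>R nabla_vec (G t) (grad (G t) (\<lambda>z. trace (H t z))) y
    - (1/2) *\<^sub>R B t y (grad (G t) (F t) y) - H t y ** nabla_vec (G t) (grad (G t) (F t)) y) *v v) (at t)"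
    unfolding X_def D_def .
qed

end

text \<open>The logarithm of the volume density is a potential of the kind required in \<open>hessian_variation\<close>, since
  the reference density \<open>\<omega>\<close> does not depend on time.\<close>

lemma (in codazzi_path) log_volume:
  assumes \<omega>: "smooth_on U \<omega>" "\<And>y. y \<in> U \<Longrightarrow> \<omega> y \<noteq> 0"
    and F: "\<And>t y. t \<in> T \<Longrightarrow> y \<in> U \<Longrightarrow> F t y = (1/2) *\<^sub>R (ln (det (G t y)) - ln ((\<omega> y)\<^sup>2))"
  shows "smooth_family T U F"
    and "t \<in> T \<Longrightarrow> y \<in> U \<Longrightarrow> dt F t y = (1/2) *\<^sub>R trace (H t y)"
proof -
  have det: "det (G t y) > 0" if "t \<in> T" "y \<in> U" for t y
    by (rule inner_product_matrix_det_pos[OF inner_G[OF that]])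
  have 1: "smooth_family T U (\<lambda>t y. ln (det (G t y)))"
    unfolding smooth_family_def
    by (rule smooth_on_ln_det[OF open_Times[OF open_time open_space] smooth_G[unfolded smooth_family_def]])
       (use det in auto)
  have 2: "smooth_family T U (\<lambda>t y. ln ((\<omega> y)\<^sup>2))"
    by (rule smooth_family_static[OF open_time open_space smooth_on_ln_square[OF open_space \<omega>]])
  have "smooth_family T U (\<lambda>t y. (1/2) * (ln (det (G t y)) + - ln ((\<omega> y)\<^sup>2)))"
    by (intro smooth_intros 1 2)
  then show "smooth_family T U F"
    by (rule smooth_family_cong[OF open_time open_space, rotated]) (simp add: F)
  assume t: "t \<in> T" and y: "y \<in> U"
  have "((\<lambda>s. G s y) has_derivative (\<lambda>r. r *\<^sub>R dt G t y)) (at t)"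
    using smooth_family_time(1)[OF smooth_G t y] by (simp add: has_vector_derivative_def)
  from has_derivative_ln_det[OF this det[OF t y]]
  have "((\<lambda>s. ln (det (G s y))) has_vector_derivative trace (H t y)) (at t)"
    by (simp add: has_vector_derivative_def H_def sharp_def matrix_mult_expand
        linear_scale[OF bounded_linear.linear[OF bounded_linear_trace]])
  then have "((\<lambda>s. (1/2) *\<^sub>R (ln (det (G s y)) - ln ((\<omega> y)\<^sup>2))) has_vector_derivative
      (1/2) *\<^sub>R (trace (H t y) - 0)) (at t)"
    by (intro bounded_linear.has_vector_derivative[OF bounded_linear_scaleR_right]
        has_vector_derivative_diff has_vector_derivative_const)
  then have "((\<lambda>s. F s y) has_vector_derivative (1/2) *\<^sub>R (trace (H t y) - 0)) (at t)"
    by (rule has_vector_derivative_transform_within_open[OF _ open_time t]) (simp add: F y)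
  then show "dt F t y = (1/2) *\<^sub>R trace (H t y)"
    unfolding dt_def by (simp add: vector_derivative_at)
qed

section \<open>Paths of Kaehler structures\<close>

text \<open>In the application \<open>N\<close> is the Hessian, \<open>Q\<close> the covariant derivative of the divergence of \<open>h\<close> and \<open>R\<close>
  the covariant derivative of \<open>h\<close> along the gradient. Splitting into linear and anti-linear parts, the anti-linear
  part of \<open>h N\<close> is \<open>h\<^sup>1\<^sup>,\<^sup>0 N\<^sup>0\<^sup>,\<^sup>1 + h\<^sup>0\<^sup>,\<^sup>1 N\<^sup>1\<^sup>,\<^sup>0\<close>, and the terms with \<open>J'\<close> supply the commutator and the remaining
  products with \<open>h\<^sup>0\<^sup>,\<^sup>1\<close>.\<close>

lemma kaehler_variation_algebra:
  fixes J N h Q R :: "real^'n::finite^'n"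
  assumes JJ: "J ** J = - mat 1"
    and dJ: "J' = (1/2) *\<^sub>R (J ** h - h ** J)"
    and dN: "N' = (1/2) *\<^sub>R Q - (1/2) *\<^sub>R R - h ** N"
  shows "N' + (J ** N ** J' + (J ** N' + J' ** N) ** J) =
    (1/2) *\<^sub>R (Q + J ** Q ** J) - part01 J R - part01 J h ** part10 J N - part10 J N ** part01 J h
    + commutator (part01 J N) (part01 J h) - 2 *\<^sub>R (part10 J h ** part01 J N)"
proof -
  have JJM: "J ** (J ** M) = - M" for M
    by (simp add: matrix_mul_assoc JJ matrix_mult_expand)
  note expand = part01_def part10_def commutator_def dJ dN matrix_mult_expand matrix_mul_assoc[symmetric] JJM JJ
  show ?thesis
    unfolding vec_eq_iff
  proof (intro allI)
    fix i j
    show "(N' + (J ** N ** J' + (J ** N' + J' ** N) ** J)) $ i $ j =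
     ((1/2) *\<^sub>R (Q + J ** Q ** J) - part01 J R - part01 J h ** part10 J N - part10 J N ** part01 J h
      + commutator (part01 J N) (part01 J h) - 2 *\<^sub>R (part10 J h ** part01 J N)) $ i $ j"
      by (simp add: expand) (simp add: field_simps)
  qed
qed

locale kaehler_path = codazzi_path T U G
  for T :: "real set" and U :: "(real^'n::finite) set" and G :: "real \<Rightarrow> real^'n \<Rightarrow> real^'n^'n" +
  fixes J :: "real \<Rightarrow> real^'n \<Rightarrow> real^'n^'n"
  assumes smooth_J: "smooth_family T U J"
    and square_J: "t \<in> T \<Longrightarrow> y \<in> U \<Longrightarrow> J t y ** J t y = - mat 1"
    and hermitian: "t \<in> T \<Longrightarrow> y \<in> U \<Longrightarrow> transpose (J t y) ** G t y ** J t y = G t y"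
    and parallel: "t \<in> T \<Longrightarrow> y \<in> U \<Longrightarrow> nabla_endo (G t) (J t) y u = 0"
    and dt_J_symmetric: "t \<in> T \<Longrightarrow> y \<in> U \<Longrightarrow> dt J t y = gtranspose (G t y) (dt J t y)"
begin

text \<open>Hermitian metrics are those for which \<open>J\<close> is skew, \<open>J\<^sup>T G = - G J\<close>. Its time derivative expresses the
  self-adjoint part of \<open>J'\<close>, which is all of \<open>J'\<close> by hypothesis, through the commutator of \<open>J\<close> and \<open>h\<close>.\<close>

lemma complex_structure_variation:
  assumes t: "t \<in> T" and y: "y \<in> U"
  shows "dt J t y = (1/2) *\<^sub>R (J t y ** H t y - H t y ** J t y)"
proof -
  let ?I = "matrix_inv (G t y)" and ?G = "G t y" and ?J = "J t y" and ?J' = "dt J t y" and ?H = "H t y"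
  note I = inner_product_matrix_inverse[OF inner_G[OF t y]]
  have skew: "transpose (J s y) ** G s y = - (G s y ** J s y)" if "s \<in> T" for s
  proof -
    have "transpose (J s y) ** G s y ** J s y ** J s y = G s y ** J s y"
      by (simp only: hermitian[OF that y])
    then have "- (transpose (J s y) ** G s y) = G s y ** J s y"
      by (simp add: matrix_mul_assoc[symmetric] square_J[OF that y] matrix_mult_expand)
    then show ?thesis by (metis minus_minus)
  qed
  have GH: "dt G t y = ?G ** ?H"
    by (simp add: H_def sharp_def matrix_mul_assoc I)
  have dJ: "((\<lambda>s. J s y) has_vector_derivative ?J') (at t)"
    by (rule smooth_family_time(1)[OF smooth_J t y])
  have dG: "((\<lambda>s. G s y) has_vector_derivative dt G t y) (at t)"
    by (rule smooth_family_time(1)[OF smooth_G t y])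
  have "transpose ?J ** dt G t y + transpose ?J' ** ?G = - (?G ** ?J' + dt G t y ** ?J)"
  proof (rule has_vector_derivative_eq[OF _ _ open_time t skew])
    show "((\<lambda>s. transpose (J s y) ** G s y) has_vector_derivative
        transpose ?J ** dt G t y + transpose ?J' ** ?G) (at t)"
      by (rule bounded_bilinear.has_vector_derivative[OF bounded_bilinear_matrix_mult
            bounded_linear.has_vector_derivative[OF bounded_linear_transpose dJ] dG])
    show "((\<lambda>s. - (G s y ** J s y)) has_vector_derivative - (?G ** ?J' + dt G t y ** ?J)) (at t)"
      by (rule has_vector_derivative_minus,
          rule bounded_bilinear.has_vector_derivative[OF bounded_bilinear_matrix_mult dG dJ])
  qed
  then have "?I ** (transpose ?J ** ?G ** ?H + transpose ?J' ** ?G) = ?I ** - (?G ** ?J' + ?G ** ?H ** ?J)"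
    by (simp only: GH matrix_mul_assoc)
  then have "- (?J ** ?H) + ?I ** transpose ?J' ** ?G = - (?J' + ?H ** ?J)"
    unfolding skew[OF t]
    by (simp add: matrix_mult_expand matrix_mul_assoc I)
  then have "- (?J ** ?H) + ?J' = - (?J' + ?H ** ?J)"
    using dt_J_symmetric[OF t y] by (simp add: gtranspose_def)
  then show ?thesis
    by (simp add: vec_eq_iff) (smt (verit) field_sum_of_halves)
qed

lemma delbar_star_variation:
  assumes t: "t \<in> T" and y: "y \<in> U"
  shows "delbar_star (G t) (J t) (\<lambda>z. part01 (J t z) (H t z)) y =
    (- (1/2)) *\<^sub>R grad (G t) (\<lambda>z. trace (H t z)) y"
proof -
  have "nabla_endo (G t) (\<lambda>z. part01 (J t z) (H t z)) y u = part01 (J t y) (B t y u)" for u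
    by (rule nabla_endo_part01[OF family_differentiable[OF smooth_H t y]
          family_differentiable[OF smooth_J t y] parallel[OF t y]])
  then show ?thesis
    unfolding grad_trace[OF t y] delbar_star_def nabla10_endo_def
    using metric_trace_part01[OF inner_G[OF t y] B_symmetric[OF t y] B_self_adjoint[OF t y]
        hermitian[OF t y] square_J[OF t y]]
    by simp
qed

text \<open>The variation formula for an arbitrary potential with \<open>f' = tr h / 2\<close>; the volume form enters only through
  this equation.\<close>

theorem delbar_grad_variation:
  assumes F: "smooth_family T U F" and t: "t \<in> T" and y: "y \<in> U"
    and dF: "\<And>z. z \<in> U \<Longrightarrow> dt F t z = (1/2) *\<^sub>R trace (H t z)"
  shows "((\<lambda>s. delbar_vec (G s) (J s) (grad (G s) (F s)) y) has_vector_derivative (1/2) *\<^sub>R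
      (- 2 *\<^sub>R delbar_vec (G t) (J t) (delbar_star (G t) (J t) (\<lambda>z. part01 (J t z) (H t z))) y
       - nabla_endo (G t) (\<lambda>z. part01 (J t z) (H t z)) y (grad (G t) (F t) y)
       - part01 (J t y) (H t y) ** del_vec (G t) (J t) (grad (G t) (F t)) y
       - del_vec (G t) (J t) (grad (G t) (F t)) y ** part01 (J t y) (H t y)
       + commutator (delbar_vec (G t) (J t) (grad (G t) (F t)) y) (part01 (J t y) (H t y))
       - 2 *\<^sub>R (part10 (J t y) (H t y) ** delbar_vec (G t) (J t) (grad (G t) (F t)) y))) (at t)"
    (is "(_ has_vector_derivative (1/2) *\<^sub>R ?rhs) _")
proof -
  define N where "N s = nabla_vec (G s) (grad (G s) (F s)) y" for s
  define X where "X = grad (G t) (F t) y"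
  define D where "D = grad (G t) (\<lambda>z. trace (H t z))"
  define Q where "Q = nabla_vec (G t) D y"
  define N' where "N' = (1/2) *\<^sub>R Q - (1/2) *\<^sub>R B t y X - H t y ** N t"
  have dN: "(N has_vector_derivative N') (at t)"
    using hessian_variation[OF F t y dF] unfolding N_def[abs_def] N'_def Q_def D_def X_def .
  have dJ: "((\<lambda>s. J s y) has_vector_derivative dt J t y) (at t)"
    by (rule smooth_family_time(1)[OF smooth_J t y])
  have dE: "((\<lambda>s. delbar_vec (G s) (J s) (grad (G s) (F s)) y) has_vector_derivative
      (1/2) *\<^sub>R (N' + (J t y ** N t ** dt J t y + (J t y ** N' + dt J t y ** N t) ** J t y))) (at t)"
    unfolding delbar_vec_def N_def[symmetric]
    by (intro bounded_linear.has_vector_derivative[OF bounded_linear_scaleR_right]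
        has_vector_derivative_add bounded_bilinear.has_vector_derivative[OF bounded_bilinear_matrix_mult] dN dJ)
  have diff_D: "D differentiable (at y)"
    unfolding D_def by (rule family_differentiable[OF smooth_grad[OF smooth_trace_H] t y])
  have "nabla_vec (G t) (delbar_star (G t) (J t) (\<lambda>z. part01 (J t z) (H t z))) y =
      nabla_vec (G t) (\<lambda>z. (- (1/2)) *\<^sub>R D z) y"
    by (rule nabla_vec_cong[OF open_space y, symmetric])
       (use delbar_star_variation[OF t] differentiable_scaleR[OF differentiable_const diff_D]
         in \<open>simp_all add: D_def\<close>)
  also have "\<dots> = (- (1/2)) *\<^sub>R Q"
    unfolding Q_def by (rule nabla_vec_scaleR[OF diff_D])
  finally have "delbar_vec (G t) (J t) (delbar_star (G t) (J t) (\<lambda>z. part01 (J t z) (H t z))) y =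
      (1/2) *\<^sub>R ((- (1/2)) *\<^sub>R Q + J t y ** ((- (1/2)) *\<^sub>R Q) ** J t y)"
    by (simp only: delbar_vec_def)
  then have lap: "- 2 *\<^sub>R delbar_vec (G t) (J t) (delbar_star (G t) (J t) (\<lambda>z. part01 (J t z) (H t z))) y =
      (1/2) *\<^sub>R (Q + J t y ** Q ** J t y)"
    by (simp add: matrix_mult_expand) (simp add: vec_eq_iff field_simps)
  have transport: "nabla_endo (G t) (\<lambda>z. part01 (J t z) (H t z)) y X = part01 (J t y) (B t y X)"
    by (rule nabla_endo_part01[OF family_differentiable[OF smooth_H t y]
          family_differentiable[OF smooth_J t y] parallel[OF t y]])
  have "?rhs = N' + (J t y ** N t ** dt J t y + (J t y ** N' + dt J t y ** N t) ** J t y)"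
    unfolding lap X_def[symmetric] transport
      kaehler_variation_algebra[OF square_J[OF t y] complex_structure_variation[OF t y] N'_def]
    by (simp only: delbar_vec_def del_vec_def part01_def part10_def N_def)
  with dE show ?thesis by simp
qed

end

theorem lemma9:
  fixes X :: "'m::t2_space set"
    and A :: "('m, 'n::finite) chart set"
    and T :: "real set"
    and g J :: "real \<Rightarrow> ('m, 'n, real^'n^'n) field"
    and \<Omega> :: "('m, 'n, real) field"
    and f :: "real \<Rightarrow> ('m, 'n, real) field"
    and h h10 h01 :: "real \<Rightarrow> ('m, 'n, real^'n^'n) field"
  assumes manifold: "compact_manifold X A"
    and T: "open T" "is_interval T"
    and path: "smooth_kaehler_path A T J g"
    and J_symmetric: "\<forall>t\<in>T. \<forall>c\<in>A. \<forall>y\<in>chart_img c.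
          time_deriv J t c y = gtranspose (g t c y) (time_deriv J t c y)"
    and g_in_F: "\<forall>t\<in>T. time_deriv g t \<in> F_space A (g t)"
    and vol: "volume_form A \<Omega>"
    and f_eq: "f = (\<lambda>t. log_volume_ratio \<Omega> (g t))"
    and h_eq: "h = (\<lambda>t c y. sharp (g t c y) (time_deriv g t c y))"
    and h10_eq: "h10 = (\<lambda>t c y. part10 (J t c y) (h t c y))"
    and h01_eq: "h01 = (\<lambda>t c y. part01 (J t c y) (h t c y))"
  shows "\<forall>t\<in>T. \<forall>c\<in>A. \<forall>y\<in>chart_img c.
     (\<lambda>s. delbar_vec (g s c) (J s c) (grad (g s c) (f s c)) y) differentiable (at t) \<and>
     2 *\<^sub>R vector_derivative (\<lambda>s. delbar_vec (g s c) (J s c) (grad (g s c) (f s c)) y) (at t) =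
       - 2 *\<^sub>R delbar_vec (g t c) (J t c) (delbar_star (g t c) (J t c) (h01 t c)) y
       - nabla_endo (g t c) (h01 t c) y (grad (g t c) (f t c) y)
       - h01 t c y ** del_vec (g t c) (J t c) (grad (g t c) (f t c)) y
       - del_vec (g t c) (J t c) (grad (g t c) (f t c)) y ** h01 t c y
       + commutator (delbar_vec (g t c) (J t c) (grad (g t c) (f t c)) y) (h01 t c y)
       - 2 *\<^sub>R (h10 t c y ** delbar_vec (g t c) (J t c) (grad (g t c) (f t c)) y)"
proof (intro ballI)
  fix t c y
  assume t: "t \<in> T" and c: "c \<in> A" and y: "y \<in> chart_img c"
  let ?U = "chart_img c" and ?G = "\<lambda>s. g s c" and ?J = "\<lambda>s. J s c"
  have U: "open ?U"
    using manifold c by (auto simp: compact_manifold_def smooth_atlas_def)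
  have smooth: "smooth_family T ?U ?G" "smooth_family T ?U ?J"
    using path c
    unfolding smooth_kaehler_path_def smooth_path_def smooth_family_def case_prod_unfold by blast+
  have kaehler: "kaehler_structure A (J s) (g s)" if "s \<in> T" for s
    using path that by (simp add: smooth_kaehler_path_def)
  have dt_eq: "dt (\<lambda>s. S s c) s z = time_deriv S s c z" for S :: "real \<Rightarrow> ('m, 'n, real^'n^'n) field" and s z
    by (simp add: dt_def time_deriv_def)
  have inner: "inner_product_matrix (g s c z)" if "s \<in> T" "z \<in> ?U" for s z
    using kaehler[OF that(1)] c that(2) by (auto simp: kaehler_structure_def riemannian_metric_def)
  interpret codazzi_path T ?U ?G
  proof unfold_locales
    fix s z u w
    assume s: "s \<in> T" and z: "z \<in> ?U"
    show "nabla_endo (g s c) (\<lambda>z. sharp (g s c z) (dt ?G s z)) z u *v w =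
        nabla_endo (g s c) (\<lambda>z. sharp (g s c z) (dt ?G s z)) z w *v u"
      using g_in_F s z c unfolding dt_eq F_space_def by blast
  qed (use T U smooth inner in auto)
  interpret kaehler_path T ?U ?G ?J
  proof unfold_locales
    fix s z u
    assume s: "s \<in> T" and z: "z \<in> ?U"
    show "J s c z ** J s c z = - mat 1"
      using kaehler[OF s] c z by (auto simp: kaehler_structure_def almost_complex_def)
    show "transpose (J s c z) ** g s c z ** J s c z = g s c z" "nabla_endo (g s c) (J s c) z u = 0"
      using kaehler[OF s] c z unfolding kaehler_structure_def by blast+
    show "dt ?J s z = gtranspose (g s c z) (dt ?J s z)"
      using J_symmetric s z c unfolding dt_eq by blast
  qed (use smooth in auto)
  have H: "H s z = h s c z" for s z
    by (simp add: H_def h_eq dt_eq)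
  have vol': "smooth_on ?U (\<Omega> c)" "\<And>z. z \<in> ?U \<Longrightarrow> \<Omega> c z \<noteq> 0"
    using vol c by (auto simp: volume_form_def smooth_field_def)
  have f: "f s c z = (1/2) *\<^sub>R (ln (det (g s c z)) - ln ((\<Omega> c z)\<^sup>2))" if "s \<in> T" "z \<in> ?U" for s z
    unfolding f_eq
    by (rule log_volume_ratio_eq)
       (use vol'(2)[OF that(2)] inner_product_matrix_det_pos[OF inner[OF that]] in simp_all)
  have smooth_f: "smooth_family T ?U (\<lambda>s. f s c)"
    by (rule log_volume(1)[where \<omega> = "\<Omega> c"]) (simp_all only: vol' f simp_thms)
  have dt_f: "dt (\<lambda>s. f s c) t z = (1/2) *\<^sub>R trace (H t z)" if "z \<in> ?U" for z
    by (rule log_volume(2)[where \<omega> = "\<Omega> c"]) (simp_all only: vol' f t that simp_thms)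
  have h01: "h01 t c = (\<lambda>z. part01 (J t c z) (H t z))" "h10 t c y = part10 (J t c y) (H t y)"
    by (simp_all add: h01_eq h10_eq H fun_eq_iff)
  note var = delbar_grad_variation[OF smooth_f t y dt_f, folded h01]
  have h01': "part01 (J t c y) (H t y) = h01 t c y"
    by (simp add: h01(1))
  show "(\<lambda>s. delbar_vec (g s c) (J s c) (grad (g s c) (f s c)) y) differentiable (at t) \<and>
     2 *\<^sub>R vector_derivative (\<lambda>s. delbar_vec (g s c) (J s c) (grad (g s c) (f s c)) y) (at t) =
       - 2 *\<^sub>R delbar_vec (g t c) (J t c) (delbar_star (g t c) (J t c) (h01 t c)) y
       - nabla_endo (g t c) (h01 t c) y (grad (g t c) (f t c) y)
       - h01 t c y ** del_vec (g t c) (J t c) (grad (g t c) (f t c)) y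
       - del_vec (g t c) (J t c) (grad (g t c) (f t c)) y ** h01 t c y
       + commutator (delbar_vec (g t c) (J t c) (grad (g t c) (f t c)) y) (h01 t c y)
       - 2 *\<^sub>R (h10 t c y ** delbar_vec (g t c) (J t c) (grad (g t c) (f t c)) y)"
    using differentiableI_vector[OF var] vector_derivative_at[OF var]
    by (simp add: h01')
qed

end
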